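(* Let $G=\mathrm{PSL}(2,\mathbb C)$ and let $P\subset G$ be the image of the group of upper triangular matrices with $1$ on the diagonal. Generators of $\bar B_3(G,P)$ are in one-one correspondence with congruence classes of decorated ideal simplices in hyperbolic $3$-space. The correspondence sends the generator represented by a labeling $\{g^{ij}\}$ to the congruence class of the ideal simplex with vertices $v_i=g^{ij}\infty$ (independent of $j$), decorated so that the intersection triangle at $v_i$, viewed as a triangle in $\mathbb C$ up to translation by means of the euclidean horosphere at $v_i$, coincides with the cut-off triangle at the $i$-th vertex (the triangle in $\mathbb C$, up to translation, whose oriented edge from vertex $ij$ to vertex $ik$ is the complex number $\alpha^i_{jk}$).
   Context: Truncated complex. A truncated $3$-simplex has vertices indexed by ordered pairs $ij$ of distinct elements of $\{0,1,2,3\}$ (vertex $ij$ lies near the $i$-th vertex of the simplex, on the edge going to the $j$-th vertex). $\bar C_3(G,P)$ is the free abelian group on labelings $\{g^{ij}\}$ by elements of $G$ such that (i) for fixed $i$ the elements $g^{ij}$ ($j\ne i$) are pairwise distinct and lie in the same left $P$-coset; (ii) each $(g^{ij})^{-1}g^{ji}$ is counter diagonal, i.e. of the form $\begin{pmatrix}0 & -a^{-1} \\ a & 0\end{pmatrix}$. $G$ acts by left multiplication, and $\bar B_3(G,P)=\bar C_3(G,P)\otimes_{\mathbb Z[G]}\mathbb Z$; its generators are the $G$-orbits of such labelings. Put $\alpha^i_{jk}=(g^{ij})^{-1}g^{ik}\in P$, regarded as a complex number via $\begin{pmatrix}1&x\\0&1\end{pmatrix}\leftrightarrow x$. Geometry.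 $\mathbb H^3$ is the upper half space model, $\partial\bar{\mathbb H}^3=\mathbb C\cup\{\infty\}$, with $G$ acting by orientation preserving isometries. An ideal simplex is a geodesic simplex with an ordered $4$-tuple of distinct vertices in $\partial\bar{\mathbb H}^3$. Horospheres at $\infty$ are oriented counterclockwise as viewed from $\infty$, and all horospheres are oriented by transporting this orientation with $G$. A euclidean horosphere is a horosphere together with an orientation preserving isometry (for its induced flat metric) to $\mathbb C$; two euclidean horospheres based at the same point are considered equal if the isometries differ by a translation. $G$ acts on the set of euclidean horospheres (by moving the horosphere and precomposing the isometry with the inverse). A decoration of an ideal simplex is a choice of a euclidean horosphere based at each of its vertices. Two decorated ideal simplices are congruent if they differ by an element of $G$. The intersection triangle at an ideal vertex is the euclidean triangle in which a horosphere based at that vertex meets the simplex; the decoration identifies it with a triangle in $\mathbb C$ well defined up to translation, with the corner on the edge $v_iv_j$ corresponding to vertex $ij$ of the truncated simplex. *)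

theory Defs
  imports "HOL-Analysis.Analysis" "HOL-Algebra.Free_Abelian_Groups" "HOL-Algebra.Generated_Groups"
begin

section \<open>The groups\<close>

definition SL2 :: "(complex^2^2) monoid" where
  "SL2 = \<lparr>carrier = {A. det A = 1}, monoid.mult = (**), one = mat 1\<rparr>"

definition PSL2 :: "(complex^2^2) set monoid" where
  "PSL2 = SL2 Mod {mat 1, - mat 1}"

definition mat2 :: "complex \<Rightarrow> complex \<Rightarrow> complex \<Rightarrow> complex \<Rightarrow> complex^2^2" where
  "mat2 a b c d = vector [vector [a, b], vector [c, d]]"

definition psl_of :: "complex^2^2 \<Rightarrow> (complex^2^2) set" where
  "psl_of A = {mat 1, - mat 1} #>\<^bsub>SL2\<^esub> A"

definition unipotent :: "(complex^2^2) set set" where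
  "unipotent = {psl_of (mat2 1 x 0 1) | x. True}"

definition counter_diagonal :: "(complex^2^2) set set" where
  "counter_diagonal = {psl_of (mat2 0 (- inverse a) a 0) | a. a \<noteq> 0}"


section \<open>The truncated complex in degree 3\<close>

text \<open>The numeral type \<^typ>\<open>4\<close> has exactly the elements 0, 1, 2, 3.\<close>

definition truncated_vertices :: "(4 \<times> 4) set" where
  "truncated_vertices = {(i, j). i \<noteq> j}"

type_synonym labeling = "4 \<times> 4 \<Rightarrow> (complex^2^2) set"

definition labelings :: "labeling set" where
  "labelings = {l \<in> truncated_vertices \<rightarrow>\<^sub>E carrier PSL2.
     (\<forall>i j k. i \<noteq> j \<and> i \<noteq> k \<and> j \<noteq> k \<longrightarrow>
        l (i, j) \<noteq> l (i, k) \<and>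
        l (i, j) <#\<^bsub>PSL2\<^esub> unipotent = l (i, k) <#\<^bsub>PSL2\<^esub> unipotent) \<and>
     (\<forall>i j. i \<noteq> j \<longrightarrow>
        inv\<^bsub>PSL2\<^esub> l (i, j) \<otimes>\<^bsub>PSL2\<^esub> l (j, i) \<in> counter_diagonal)}"

definition label_act :: "(complex^2^2) set \<Rightarrow> labeling \<Rightarrow> labeling" where
  "label_act g l = restrict (\<lambda>ij. g \<otimes>\<^bsub>PSL2\<^esub> l ij) truncated_vertices"

definition Cbar3 :: "(labeling \<Rightarrow>\<^sub>0 int) monoid" where
  "Cbar3 = free_Abelian_group labelings"

definition chain_act :: "(complex^2^2) set \<Rightarrow> (labeling \<Rightarrow>\<^sub>0 int) \<Rightarrow> (labeling \<Rightarrow>\<^sub>0 int)" where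
  "chain_act g = frag_extend (\<lambda>l. frag_of (label_act g l))"

text \<open>The tensor product over the group ring with the trivial module is the group of
  coinvariants: the quotient by the subgroup generated by all differences \<open>g c - c\<close>.\<close>

definition coinvariant_relations :: "(labeling \<Rightarrow>\<^sub>0 int) set" where
  "coinvariant_relations =
     generate Cbar3 {chain_act g c - c | g c. g \<in> carrier PSL2 \<and> c \<in> carrier Cbar3}"

definition Bbar3 :: "(labeling \<Rightarrow>\<^sub>0 int) set monoid" where
  "Bbar3 = Cbar3 Mod coinvariant_relations"

definition generator :: "labeling \<Rightarrow> (labeling \<Rightarrow>\<^sub>0 int) set" where
  "generator l = coinvariant_relations #>\<^bsub>Cbar3\<^esub> frag_of l"

text \<open>The classes of the labelings; the lemma \<open>generator_eq_iff\<close> at the end of this theory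
  identifies them with the orbits of labelings.\<close>

definition Bbar3_generators :: "(labeling \<Rightarrow>\<^sub>0 int) set set" where
  "Bbar3_generators = generator ` labelings"

definition alpha :: "labeling \<Rightarrow> 4 \<Rightarrow> 4 \<Rightarrow> 4 \<Rightarrow> complex" where
  "alpha l i j k =
     (THE x. inv\<^bsub>PSL2\<^esub> l (i, j) \<otimes>\<^bsub>PSL2\<^esub> l (i, k) = psl_of (mat2 1 x 0 1))"


section \<open>Upper half space\<close>

text \<open>A pair \<open>(z, t)\<close> of type \<^typ>\<open>complex \<times> real\<close> with \<open>t > 0\<close> is a point of upper half
  space, with metric \<open>(|dz|\<^sup>2 + dt\<^sup>2) / t\<^sup>2\<close>; the product norm on this type is the
  Euclidean norm.\<close>

datatype boundary = Fin complex | Infinity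

fun sl_boundary_act :: "complex^2^2 \<Rightarrow> boundary \<Rightarrow> boundary" where
  "sl_boundary_act A Infinity = (if A$2$1 = 0 then Infinity else Fin (A$1$1 / A$2$1))"
| "sl_boundary_act A (Fin z) =
     (if A$2$1 * z + A$2$2 = 0 then Infinity
      else Fin ((A$1$1 * z + A$1$2) / (A$2$1 * z + A$2$2)))"

text \<open>The Poincare extension of a Moebius transformation, that is,
  \<open>(a q + b) (c q + d)\<close>\<open>\<^sup>-\<^sup>1\<close> for the quaternion \<open>q = z + t j\<close>.\<close>

definition sl_act :: "complex^2^2 \<Rightarrow> complex \<times> real \<Rightarrow> complex \<times> real" where
  "sl_act A = (\<lambda>(z, t).
     let a = A$1$1; b = A$1$2; c = A$2$1; d = A$2$2;
         N = (cmod (c * z + d))\<^sup>2 + (cmod c)\<^sup>2 * t\<^sup>2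
     in (((a * z + b) * cnj (c * z + d) + a * cnj c * of_real (t\<^sup>2)) / of_real N, t / N))"

text \<open>Both matrices representing an element of \<^const>\<open>PSL2\<close> act in the same way, so the
  images below are singletons.\<close>

definition boundary_act :: "(complex^2^2) set \<Rightarrow> boundary \<Rightarrow> boundary" where
  "boundary_act g p = the_elem ((\<lambda>A. sl_boundary_act A p) ` g)"

definition hyp_act :: "(complex^2^2) set \<Rightarrow> complex \<times> real \<Rightarrow> complex \<times> real" where
  "hyp_act g x = the_elem ((\<lambda>A. sl_act A x) ` g)"

fun ideal_geodesic :: "boundary \<Rightarrow> boundary \<Rightarrow> (complex \<times> real) set" where
  "ideal_geodesic Infinity (Fin w) = {(z, t). t > 0 \<and> z = w}"
| "ideal_geodesic (Fin w) Infinity = {(z, t). t > 0 \<and> z = w}"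
| "ideal_geodesic (Fin w) (Fin w') =
     {(z, t). t > 0 \<and> z \<in> closed_segment w w' \<and>
        dist (z, t) (midpoint w w', 0) = dist w w' / 2}"
| "ideal_geodesic Infinity Infinity = {}"


section \<open>Euclidean horospheres\<close>

fun horosphere :: "boundary \<Rightarrow> (complex \<times> real) set \<Rightarrow> bool" where
  "horosphere Infinity H \<longleftrightarrow> (\<exists>h > 0. H = {(z, t). t = h})"
| "horosphere (Fin w) H \<longleftrightarrow> (\<exists>r > 0. H = sphere (w, r) r - {(w, 0)})"

text \<open>\<open>Im (cnj (D 1) * D \<i>)\<close> is the determinant of the real linear map \<open>D\<close>
  in the basis \<open>1, \<i>\<close>.\<close>

definition orientation_preserving :: "(complex \<Rightarrow> complex) \<Rightarrow> bool" where
  "orientation_preserving f \<longleftrightarrow>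
     (\<forall>w. \<exists>D. (f has_derivative D) (at w) \<and> Im (cnj (D 1) * D \<i>) > 0)"

text \<open>Euclidean horospheres based at \<open>v\<close>, before identification up to translation. Writing
  \<open>\<psi>\<close> for the inverse of \<open>\<phi>\<close>, the condition on the derivative says
  that \<open>\<psi>\<close> pulls the metric induced by \<open>(|dz|\<^sup>2 + dt\<^sup>2) / t\<^sup>2\<close> on \<open>H\<close>
  back to the Euclidean metric of \<open>\<complex>\<close>. The last condition compares orientations: a horosphere
  at infinity carries the standard orientation of its first coordinate (counterclockwise
  as viewed from infinity), and \<open>H\<close> the orientation transported from there by an
  element of the group.\<close>

type_synonym ehorosphere = "(complex \<times> real) set \<times> (complex \<times> real \<Rightarrow> complex)"

definition ehorospheres :: "boundary \<Rightarrow> ehorosphere set" where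
  "ehorospheres v = {(H, \<phi>).
     horosphere v H \<and> \<phi> \<in> extensional H \<and> bij_betw \<phi> H UNIV \<and>
     (let \<psi> = inv_into H \<phi> in
        (\<forall>w. \<exists>D. (\<psi> has_derivative D) (at w) \<and>
                 (\<forall>\<xi>. norm (D \<xi>) / snd (\<psi> w) = norm \<xi>)) \<and>
        (\<forall>g \<in> carrier PSL2. boundary_act g Infinity = v \<longrightarrow>
           orientation_preserving (\<lambda>w. fst (hyp_act (inv\<^bsub>PSL2\<^esub> g) (\<psi> w)))))}"

definition translation_rel :: "(ehorosphere \<times> ehorosphere) set" where
  "translation_rel =
     {((H, \<phi>), (H', \<phi>')). H' = H \<and> (\<exists>c. \<phi>' = restrict (\<lambda>x. \<phi> x + c) H)}"

definition ehorosphere_act :: "(complex^2^2) set \<Rightarrow> ehorosphere \<Rightarrow> ehorosphere" where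
  "ehorosphere_act g = (\<lambda>(H, \<phi>).
     (hyp_act g ` H,
      restrict (\<lambda>x. \<phi> (hyp_act (inv\<^bsub>PSL2\<^esub> g) x)) (hyp_act g ` H)))"


section \<open>Decorated ideal simplices\<close>

text \<open>An ideal simplex is determined by its ordered vertices. The decoration assigns to each vertex
  an equivalence class of euclidean horospheres under translation.\<close>

type_synonym decorated_simplex = "(4 \<Rightarrow> boundary) \<times> (4 \<Rightarrow> ehorosphere set)"

definition decorated_simplices :: "decorated_simplex set" where
  "decorated_simplices =
     {(v, E). inj v \<and> (\<forall>i. E i \<in> ehorospheres (v i) // translation_rel)}"

definition decorated_act ::
    "(complex^2^2) set \<Rightarrow> decorated_simplex \<Rightarrow> decorated_simplex" where
  "decorated_act g = (\<lambda>(v, E). (\<lambda>i. boundary_act g (v i), \<lambda>i. ehorosphere_act g ` E i))"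

definition congruence :: "(decorated_simplex \<times> decorated_simplex) set" where
  "congruence = {(D, D'). D \<in> decorated_simplices \<and> D' \<in> decorated_simplices \<and>
     (\<exists>g \<in> carrier PSL2. D' = decorated_act g D)}"

text \<open>Triangles in \<open>\<complex>\<close> at vertex \<open>i\<close> are given by their corners, labelled by the indices
  \<open>j \<noteq> i\<close>; a triangle up to translation is a translation class of such maps. The corner
  of the intersection triangle labelled \<open>j\<close> is the point where the horosphere meets the edge
  towards \<open>v j\<close>. Edges are extended to complete geodesics, since the horosphere may be so
  large that it also crosses the face opposite to \<open>v i\<close>.\<close>

definition intersection_corner ::
    "(complex \<times> real) set \<Rightarrow> boundary \<Rightarrow> boundary \<Rightarrow> complex \<times> real" where
  "intersection_corner H p q = (THE x. x \<in> H \<inter> ideal_geodesic p q)"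

definition intersection_triangle :: "decorated_simplex \<Rightarrow> 4 \<Rightarrow> (4 \<Rightarrow> complex) set" where
  "intersection_triangle D i = (case D of (v, E) \<Rightarrow>
     (\<lambda>(H, \<phi>). restrict (\<lambda>j. \<phi> (intersection_corner H (v i) (v j))) {j. j \<noteq> i}) ` E i)"

definition cutoff_triangle :: "labeling \<Rightarrow> 4 \<Rightarrow> (4 \<Rightarrow> complex) set" where
  "cutoff_triangle l i = {T \<in> extensional {j. j \<noteq> i}.
     \<forall>j k. j \<noteq> i \<and> k \<noteq> i \<longrightarrow> T k - T j = alpha l i j k}"

definition corresponds :: "labeling \<Rightarrow> decorated_simplex \<Rightarrow> bool" where
  "corresponds l D \<longleftrightarrow>
     (\<forall>i j. i \<noteq> j \<longrightarrow> fst D i = boundary_act (l (i, j)) Infinity) \<and>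
     (\<forall>i. intersection_triangle D i = cutoff_triangle l i)"


section \<open>Generators are orbits of labelings\<close>

lemma SL2_simps: "A \<in> carrier SL2 \<longleftrightarrow> det A = 1" "A \<otimes>\<^bsub>SL2\<^esub> B = A ** B" "\<one>\<^bsub>SL2\<^esub> = mat 1"
  by (simp_all add: SL2_def)

lemma group_SL2: "group SL2"
proof (rule groupI)
  fix A assume "A \<in> carrier SL2"
  then have d: "det A = 1" by (simp add: SL2_simps)
  then obtain B where B: "A ** B = mat 1" "B ** A = mat 1"
    using invertible_det_nz[of A] unfolding invertible_def by auto
  have "det (B ** A) = 1" by (simp add: B)
  then have "det B = 1" using d by (simp add: det_mul)
  then show "\<exists>y\<in>carrier SL2. y \<otimes>\<^bsub>SL2\<^esub> A = \<one>\<^bsub>SL2\<^esub>"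
    using B(2) by (intro bexI[of _ B]) (simp_all add: SL2_simps)
qed (simp_all add: SL2_simps det_mul matrix_mul_assoc)

lemma normal_pm1: "normal {mat 1, - mat 1} SL2"
proof -
  interpret S: group SL2 by (rule group_SL2)
  have n1: "det (- mat 1 :: complex^2^2) = 1" by (simp add: det_2 mat_def)
  have m: "A ** (- B) = - (A ** B)" "(- A) ** B = - (A ** B)" for A B :: "complex^2^2"
    by (simp_all add: matrix_matrix_mult_def vec_eq_iff sum_negf)
  have "subgroup {mat 1, - mat 1} SL2"
  proof (rule S.subgroupI)
    fix a :: "complex^2^2" assume a: "a \<in> {mat 1, - mat 1}"
    have "inv\<^bsub>SL2\<^esub> a = a"
      by (rule S.inv_equality) (use a n1 in \<open>auto simp: SL2_def m\<close>)
    then show "inv\<^bsub>SL2\<^esub> a \<in> {mat 1, - mat 1}" using a by simp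
  qed (use n1 in \<open>auto simp: SL2_def m\<close>)
  then show ?thesis
    by (rule S.normalI) (auto simp: r_coset_def l_coset_def SL2_def m)
qed

lemma group_PSL2: "group PSL2"
  unfolding PSL2_def by (rule normal.factorgroup_is_group[OF normal_pm1])

lemma unipotent_subset: "unipotent \<subseteq> carrier PSL2"
proof -
  have "det (mat2 1 x 0 1) = 1" for x by (simp add: mat2_def det_2)
  then show ?thesis
    by (auto simp: unipotent_def psl_of_def PSL2_def FactGroup_def RCOSETS_def SL2_def)
qed

lemma label_act_labelings:
  assumes g: "g \<in> carrier PSL2" and l: "l \<in> labelings"
  shows "label_act g l \<in> labelings"
proof -
  interpret G: group PSL2 by (rule group_PSL2)
  have c: "l (i, j) \<in> carrier PSL2" if "i \<noteq> j" for i j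
    using l that by (auto simp: labelings_def truncated_vertices_def)
  have v: "label_act g l (i, j) = g \<otimes>\<^bsub>PSL2\<^esub> l (i, j)" if "i \<noteq> j" for i j
    using that by (simp add: label_act_def truncated_vertices_def)
  have q: "inv\<^bsub>PSL2\<^esub> (g \<otimes>\<^bsub>PSL2\<^esub> a) \<otimes>\<^bsub>PSL2\<^esub> (g \<otimes>\<^bsub>PSL2\<^esub> b) = inv\<^bsub>PSL2\<^esub> a \<otimes>\<^bsub>PSL2\<^esub> b"
    if "a \<in> carrier PSL2" "b \<in> carrier PSL2" for a b
  proof -
    have "inv\<^bsub>PSL2\<^esub> (g \<otimes>\<^bsub>PSL2\<^esub> a) \<otimes>\<^bsub>PSL2\<^esub> (g \<otimes>\<^bsub>PSL2\<^esub> b) =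
        inv\<^bsub>PSL2\<^esub> a \<otimes>\<^bsub>PSL2\<^esub> (inv\<^bsub>PSL2\<^esub> g \<otimes>\<^bsub>PSL2\<^esub> (g \<otimes>\<^bsub>PSL2\<^esub> b))"
      using that g by (simp add: G.inv_mult_group G.m_assoc)
    also have "inv\<^bsub>PSL2\<^esub> g \<otimes>\<^bsub>PSL2\<^esub> (g \<otimes>\<^bsub>PSL2\<^esub> b) = b"
      using that g by (simp flip: G.m_assoc)
    finally show ?thesis .
  qed
  have s: "(g \<otimes>\<^bsub>PSL2\<^esub> a) <#\<^bsub>PSL2\<^esub> unipotent = g <#\<^bsub>PSL2\<^esub> (a <#\<^bsub>PSL2\<^esub> unipotent)"
    if "a \<in> carrier PSL2" for a
    using that g unipotent_subset by (simp add: G.lcos_m_assoc)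
  have "label_act g l \<in> truncated_vertices \<rightarrow>\<^sub>E carrier PSL2"
    using g c by (auto simp: label_act_def truncated_vertices_def)
  moreover have "label_act g l (i, j) \<noteq> label_act g l (i, k) \<and>
      label_act g l (i, j) <#\<^bsub>PSL2\<^esub> unipotent = label_act g l (i, k) <#\<^bsub>PSL2\<^esub> unipotent"
    if "i \<noteq> j" "i \<noteq> k" "j \<noteq> k" for i j k
  proof -
    have "l (i, j) \<noteq> l (i, k)"
         "l (i, j) <#\<^bsub>PSL2\<^esub> unipotent = l (i, k) <#\<^bsub>PSL2\<^esub> unipotent"
      using l that unfolding labelings_def by blast+
    then show ?thesis using that g c by (simp add: v s)
  qed
  moreover have "inv\<^bsub>PSL2\<^esub> label_act g l (i, j) \<otimes>\<^bsub>PSL2\<^esub> label_act g l (j, i) \<in> counter_diagonal"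
    if "i \<noteq> j" for i j
    using l that c by (simp add: v q) (simp add: labelings_def)
  ultimately show ?thesis unfolding labelings_def by blast
qed

lemma label_act_mult:
  assumes "g \<in> carrier PSL2" "h \<in> carrier PSL2" "l \<in> labelings"
  shows "label_act g (label_act h l) = label_act (g \<otimes>\<^bsub>PSL2\<^esub> h) l"
proof -
  interpret G: group PSL2 by (rule group_PSL2)
  have "l x \<in> carrier PSL2" if "x \<in> truncated_vertices" for x
    using assms(3) that by (auto simp: labelings_def)
  then show ?thesis
    using assms(1,2) unfolding label_act_def by (intro restrict_ext) (simp add: G.m_assoc)
qed

lemma label_act_one:
  assumes "l \<in> labelings"
  shows "label_act \<one>\<^bsub>PSL2\<^esub> l = l"
proof -
  interpret G: group PSL2 by (rule group_PSL2)
  have l: "l \<in> truncated_vertices \<rightarrow>\<^sub>E carrier PSL2"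
    using assms by (simp add: labelings_def)
  show ?thesis
  proof
    fix x
    show "label_act \<one>\<^bsub>PSL2\<^esub> l x = l x"
    proof (cases "x \<in> truncated_vertices")
      case True
      then have "l x \<in> carrier PSL2" using l by (rule PiE_mem[rotated])
      then show ?thesis using True by (simp add: label_act_def)
    next
      case False
      then show ?thesis using PiE_arb[OF l False] by (simp add: label_act_def)
    qed
  qed
qed

lemma Bbar3_generators_subset: "Bbar3_generators \<subseteq> carrier Bbar3"
  by (auto simp: Bbar3_generators_def generator_def Bbar3_def FactGroup_def RCOSETS_def
    Cbar3_def intro!: bexI[of _ "frag_of _"])

lemma generator_eq_iff:
  assumes l: "l \<in> labelings" and m: "m \<in> labelings"
  shows "generator l = generator m \<longleftrightarrow> (\<exists>g \<in> carrier PSL2. m = label_act g l)"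
proof -
  interpret G: group PSL2 by (rule group_PSL2)
  interpret C: comm_group Cbar3
    unfolding Cbar3_def by (rule abelian_free_Abelian_group)
  have carr: "c \<in> carrier Cbar3 \<longleftrightarrow> Poly_Mapping.keys c \<subseteq> labelings" for c
    by (simp add: Cbar3_def)
  have mult: "x \<otimes>\<^bsub>Cbar3\<^esub> y = x + y" for x y by (simp add: Cbar3_def)
  let ?S = "{chain_act g c - c | g c. g \<in> carrier PSL2 \<and> c \<in> carrier Cbar3}"
  have chain: "chain_act g c \<in> carrier Cbar3"
    if "g \<in> carrier PSL2" "c \<in> carrier Cbar3" for g c
    using that keys_frag_extend[of "\<lambda>l. frag_of (label_act g l)" c] label_act_labelings
    by (fastforce simp: carr chain_act_def)
  have S: "?S \<subseteq> carrier Cbar3"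
  proof
    fix s assume "s \<in> ?S"
    then obtain g c where "s = chain_act g c - c" "g \<in> carrier PSL2" "c \<in> carrier Cbar3"
      by blast
    then show "s \<in> carrier Cbar3"
      using chain[of g c] keys_diff[of "chain_act g c" c] unfolding carr by blast
  qed
  have sub: "subgroup coinvariant_relations Cbar3"
    unfolding coinvariant_relations_def by (rule C.generate_is_subgroup[OF S])
  have fl: "frag_of l \<in> carrier Cbar3" "frag_of m \<in> carrier Cbar3" using l m by (simp_all add: carr)
  show ?thesis
  proof
    assume eq: "generator l = generator m"
    have "frag_of m \<in> generator m"
      unfolding generator_def by (rule C.rcos_self[OF fl(2) sub])
    then obtain n where n: "n \<in> coinvariant_relations" "frag_of m = n + frag_of l"
      unfolding eq[symmetric] by (auto simp: generator_def r_coset_def mult)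
    define orb where "orb = {label_act g l | g. g \<in> carrier PSL2}"
    define f where "f = (\<lambda>x. if x \<in> orb then frag_of () else 0)"
    have inv: "f (label_act g x) = f x" if g: "g \<in> carrier PSL2" and x: "x \<in> labelings" for g x
    proof -
      have "x \<in> orb" if "label_act g x \<in> orb"
      proof -
        obtain h where h: "h \<in> carrier PSL2" "label_act g x = label_act h l"
          using \<open>label_act g x \<in> orb\<close> by (auto simp: orb_def)
        have "x = label_act (inv\<^bsub>PSL2\<^esub> g) (label_act g x)"
          using g x by (simp add: label_act_mult label_act_one)
        also have "\<dots> = label_act (inv\<^bsub>PSL2\<^esub> g \<otimes>\<^bsub>PSL2\<^esub> h) l"
          using g h l by (simp add: label_act_mult)
        finally show ?thesis using g h by (auto simp: orb_def)
      qed
      moreover have "label_act g x \<in> orb" if "x \<in> orb"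
      proof -
        obtain h where h: "h \<in> carrier PSL2" "x = label_act h l"
          using \<open>x \<in> orb\<close> by (auto simp: orb_def)
        then have "label_act g x = label_act (g \<otimes>\<^bsub>PSL2\<^esub> h) l"
          using g l by (simp add: label_act_mult)
        then show ?thesis using g h by (auto simp: orb_def)
      qed
      ultimately show ?thesis by (auto simp: f_def)
    qed
    have zero: "frag_extend f s = 0" if "s \<in> ?S" for s
    proof -
      obtain g c where gc: "s = chain_act g c - c" "g \<in> carrier PSL2" "c \<in> carrier Cbar3"
        using \<open>s \<in> ?S\<close> by blast
      have "frag_extend f (chain_act g c) = frag_extend (f \<circ> label_act g) c"
        unfolding chain_act_def using frag_extend_compose[of f "label_act g" c] by (simp add: comp_def)
      also have "\<dots> = frag_extend f c"
        by (rule frag_extend_eq) (use gc inv carr in auto)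
      finally show ?thesis by (simp add: gc frag_extend_diff)
    qed
    have "frag_extend f n = 0 \<and> n \<in> carrier Cbar3"
      using n(1) unfolding coinvariant_relations_def
    proof (induction n rule: generate.induct)
      case one
      then show ?case by (simp add: Cbar3_def)
    next
      case (incl h)
      then show ?case using zero S by blast
    next
      case (inv h)
      then have "h \<in> carrier Cbar3" using S by blast
      then show ?case using zero[OF inv]
        by (simp add: Cbar3_def frag_extend_minus)
    next
      case (eng h1 h2)
      then show ?case using C.m_closed[of h1 h2] by (simp add: mult frag_extend_add)
    qed
    then have "f m = f l" using n(2) by (metis add_0 frag_extend_add frag_extend_of)
    moreover have "l \<in> orb" using label_act_one[OF l] G.one_closed by (force simp: orb_def)
    ultimately have "m \<in> orb" by (auto simp: f_def split: if_splits)
    then show "\<exists>g \<in> carrier PSL2. m = label_act g l" by (auto simp: orb_def)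
  next
    assume "\<exists>g \<in> carrier PSL2. m = label_act g l"
    then obtain g where g: "g \<in> carrier PSL2" "m = label_act g l" by blast
    have "frag_of m - frag_of l = chain_act g (frag_of l) - frag_of l"
      by (simp add: chain_act_def g(2))
    then have "frag_of m - frag_of l \<in> coinvariant_relations"
      unfolding coinvariant_relations_def using g(1) fl(1) by (blast intro: generate.incl)
    then have "frag_of m \<in> generator l"
      unfolding generator_def r_coset_def mult by force
    then show "generator l = generator m"
      unfolding generator_def using C.repr_independence[OF _ fl(1) sub] by blast
  qed
qed

end

theory Submission
  imports Defs "HOL-Complex_Analysis.Cauchy_Integral_Formula"
begin

text \<open>The horosphere of height 1 at infinity, with its first coordinate as isometry, is a standard
  euclidean horosphere, and its classes up to translation under the action of the group are all the
  euclidean horospheres: at infinity the inverse of the isometry is holomorphic with derivative of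
  constant modulus, hence affine. A group element fixing infinity preserves the standard one exactly
  if it is unipotent. So for a decorated simplex there is a unique element \<open>g\<^sup>i\<^sup>j\<close> sending
  \<open>\<infinity>\<close> to \<open>v\<^sub>i\<close>, \<open>0\<close> to \<open>v\<^sub>j\<close> and the standard horosphere to the decoration at \<open>v\<^sub>i\<close>, and
  these elements form a labeling; conversely, in a labeling the coset condition makes \<open>g\<^sup>i\<^sup>j\<infinity>\<close> and the
  transported horosphere independent of \<open>j\<close>, and counter diagonality says that \<open>g\<^sup>i\<^sup>j0 = g\<^sup>j\<^sup>i\<infinity>\<close>. The
  corners of the intersection triangle at \<open>v\<^sub>i\<close> are the images of the standard point of height 1
  above 0 under the \<open>g\<^sup>i\<^sup>j\<close>, so its edges are the \<open>\<alpha>\<close>.\<close>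

section \<open>Matrices representing elements of the group\<close>

lemma mat2_nth [simp]:
  "mat2 a b c d $ 1 $ 1 = a" "mat2 a b c d $ 1 $ 2 = b"
  "mat2 a b c d $ 2 $ 1 = c" "mat2 a b c d $ 2 $ 2 = d"
  by (simp_all add: mat2_def)

lemma matrix_2_eq_iff:
  fixes A B :: "'a^2^2"
  shows "A = B \<longleftrightarrow> A$1$1 = B$1$1 \<and> A$1$2 = B$1$2 \<and> A$2$1 = B$2$1 \<and> A$2$2 = B$2$2"
  by (auto simp: vec_eq_iff forall_2)

lemma matrix_mult_2_nth:
  fixes A B :: "complex^2^2"
  shows "(A ** B) $ i $ j = A$i$1 * B$1$j + A$i$2 * B$2$j"
  by (simp add: matrix_matrix_mult_def sum_2)

lemma mat_2_nth [simp]: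
  "(mat 1 :: complex^2^2) $ 1 $ 1 = 1" "(mat 1 :: complex^2^2) $ 1 $ 2 = 0"
  "(mat 1 :: complex^2^2) $ 2 $ 1 = 0" "(mat 1 :: complex^2^2) $ 2 $ 2 = 1"
  by (simp_all add: mat_def)

lemma det_mat2 [simp]: "det (mat2 a b c d) = a * d - b * c"
  by (simp add: det_2)

lemma minus_matrix_mult:
  fixes A B :: "complex^2^2"
  shows "A ** (- B) = - (A ** B)" "(- A) ** B = - (A ** B)"
  by (simp_all add: matrix_2_eq_iff matrix_mult_2_nth)

text \<open>The adjugate. For determinant 1 it is the inverse, so inverses in \<open>PSL2\<close>
  get explicit matrix entries.\<close>

definition adj2 :: "complex^2^2 \<Rightarrow> complex^2^2" where
  "adj2 A = mat2 (A$2$2) (- A$1$2) (- A$2$1) (A$1$1)"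

lemma adj2_nth [simp]:
  "adj2 A $ 1 $ 1 = A$2$2" "adj2 A $ 1 $ 2 = - A$1$2"
  "adj2 A $ 2 $ 1 = - A$2$1" "adj2 A $ 2 $ 2 = A$1$1"
  by (simp_all add: adj2_def)

lemma det_adj2 [simp]: "det (adj2 A) = det A"
  by (simp add: det_2)

lemma adj2_mult:
  assumes "det A = 1"
  shows "adj2 A ** A = mat 1" "A ** adj2 A = mat 1"
  using assms by (auto simp: matrix_2_eq_iff matrix_mult_2_nth det_2 algebra_simps)

text \<open>A coset of the centre is literally a pair of matrices; this turns equations in
  \<open>PSL2\<close> into matrix equations up to sign.\<close>

lemma psl_of_eq: "psl_of A = {A, - A}"
  by (auto simp: psl_of_def r_coset_def SL2_def minus_matrix_mult)

lemma psl_of_eq_iff: "psl_of A = psl_of B \<longleftrightarrow> A = B \<or> A = - B"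
  by (auto simp: psl_of_eq doubleton_eq_iff)

lemma carrier_PSL2: "carrier PSL2 = {psl_of A | A. det A = 1}"
  by (auto simp: PSL2_def FactGroup_def RCOSETS_def psl_of_def SL2_def)

lemma psl_of_carrier [simp]: "det A = 1 \<Longrightarrow> psl_of A \<in> carrier PSL2"
  by (auto simp: carrier_PSL2)

lemma psl_of_mult: "psl_of A \<otimes>\<^bsub>PSL2\<^esub> psl_of B = psl_of (A ** B)"
  by (auto simp: PSL2_def FactGroup_def set_mult_def psl_of_eq SL2_def minus_matrix_mult)

lemma one_PSL2: "\<one>\<^bsub>PSL2\<^esub> = psl_of (mat 1)"
  by (auto simp: PSL2_def FactGroup_def psl_of_eq)

interpretation PSL2: group PSL2
  by (rule group_PSL2)

lemma inv_psl_of: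
  assumes "det A = 1"
  shows "inv\<^bsub>PSL2\<^esub> psl_of A = psl_of (adj2 A)"
  by (rule PSL2.inv_equality) (use assms in \<open>simp_all add: psl_of_mult one_PSL2 adj2_mult\<close>)

section \<open>The actions on the boundary and on upper half space\<close>

lemma sl_boundary_act_uminus: "sl_boundary_act (- A) p = sl_boundary_act A p"
proof (cases p)
  case (Fin z)
  have "(- A)$2$1 * z + (- A)$2$2 = - (A$2$1 * z + A$2$2)"
    "(- A)$1$1 * z + (- A)$1$2 = - (A$1$1 * z + A$1$2)"
    by simp_all
  then show ?thesis
    by (simp only: Fin sl_boundary_act.simps neg_equal_0_iff_equal minus_divide_left[symmetric] minus_divide_right[symmetric] minus_minus)
qed simp

lemma boundary_act_psl_of: "boundary_act (psl_of A) p = sl_boundary_act A p"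
  by (simp add: boundary_act_def psl_of_eq sl_boundary_act_uminus)

text \<open>Homogeneous coordinates on the boundary, with infinity as \<open>[1 : 0]\<close>. In
  them a matrix acts linearly, so composition needs no separate treatment of vanishing
  denominators.\<close>

definition projective_point :: "complex \<Rightarrow> complex \<Rightarrow> boundary" where
  "projective_point x y = (if y = 0 then Infinity else Fin (x / y))"

lemma sl_boundary_act_projective_point:
  assumes "det A = 1" "x \<noteq> 0 \<or> y \<noteq> 0"
  shows "sl_boundary_act A (projective_point x y) =
    projective_point (A$1$1 * x + A$1$2 * y) (A$2$1 * x + A$2$2 * y)"
proof (cases "y = 0")
  case True
  then show ?thesis using assms by (auto simp: projective_point_def)
next
  case False
  have "A$2$1 * x + A$2$2 * y = y * (A$2$1 * (x / y) + A$2$2)"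
    "A$1$1 * x + A$1$2 * y = y * (A$1$1 * (x / y) + A$1$2)"
    using False by (simp_all add: field_simps)
  then show ?thesis using False by (simp add: projective_point_def)
qed

lemma projective_point_cases:
  obtains x y where "p = projective_point x y" "x \<noteq> 0 \<or> y \<noteq> 0"
proof (cases p)
  case (Fin z)
  show ?thesis by (rule that[of z 1]) (simp_all add: Fin projective_point_def)
next
  case Infinity
  show ?thesis by (rule that[of 1 0]) (simp_all add: Infinity projective_point_def)
qed

lemma sl_boundary_act_mult:
  assumes "det A = 1" "det B = 1"
  shows "sl_boundary_act (A ** B) p = sl_boundary_act A (sl_boundary_act B p)"
proof -
  obtain x y where p: "p = projective_point x y" and xy: "x \<noteq> 0 \<or> y \<noteq> 0"
    by (rule projective_point_cases)
  let ?x = "B$1$1 * x + B$1$2 * y" and ?y = "B$2$1 * x + B$2$2 * y"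
  \<comment> \<open>The adjugate of \<open>B\<close> recovers \<open>(x, y)\<close> from its image,
    so the image vector cannot vanish.\<close>
  have "B$2$2 * ?x - B$1$2 * ?y = det B * x" "B$1$1 * ?y - B$2$1 * ?x = det B * y"
    by (simp_all add: det_2 algebra_simps)
  then have "?x \<noteq> 0 \<or> ?y \<noteq> 0" using xy assms(2) by auto
  moreover have "det (A ** B) = 1" using assms by (simp add: det_mul)
  ultimately show ?thesis
    using assms xy unfolding p
    by (simp add: sl_boundary_act_projective_point matrix_mult_2_nth algebra_simps)
qed

lemma boundary_act_mult:
  assumes "g \<in> carrier PSL2" "h \<in> carrier PSL2"
  shows "boundary_act (g \<otimes>\<^bsub>PSL2\<^esub> h) p = boundary_act g (boundary_act h p)"
  using assms by (auto simp: carrier_PSL2 psl_of_mult boundary_act_psl_of sl_boundary_act_mult)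

lemma boundary_act_one: "boundary_act \<one>\<^bsub>PSL2\<^esub> p = p"
  by (cases p) (simp_all add: one_PSL2 boundary_act_psl_of)

lemma boundary_act_inv:
  assumes "g \<in> carrier PSL2"
  shows "boundary_act (inv\<^bsub>PSL2\<^esub> g) (boundary_act g p) = p"
    "boundary_act g (boundary_act (inv\<^bsub>PSL2\<^esub> g) p) = p"
  using assms by (simp_all add: boundary_act_one flip: boundary_act_mult)

lemma boundary_act_eq_iff:
  assumes "g \<in> carrier PSL2"
  shows "boundary_act g p = boundary_act g q \<longleftrightarrow> p = q"
  using boundary_act_inv(1)[OF assms] by metis

section \<open>Action on upper half space\<close>

abbreviation upper :: "(complex \<times> real) set" where
  "upper \<equiv> {x. snd x > 0}"

abbreviation sl_denom :: "complex^2^2 \<Rightarrow> complex \<times> real \<Rightarrow> real" where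
  "sl_denom A x \<equiv> (cmod (A$2$1 * fst x + A$2$2))\<^sup>2 + (cmod (A$2$1))\<^sup>2 * (snd x)\<^sup>2"

lemma sl_act_eq:
  "sl_act A x = ((((A$1$1) * fst x + A$1$2) * cnj (A$2$1 * fst x + A$2$2) +
      A$1$1 * cnj (A$2$1) * of_real ((snd x)\<^sup>2)) / of_real (sl_denom A x),
    snd x / sl_denom A x)"
  by (cases x) (simp add: sl_act_def Let_def)

lemma sl_denom_pos:
  assumes "det A = 1" "x \<in> upper"
  shows "sl_denom A x > 0"
proof (cases "A$2$1 = 0")
  case True
  then show ?thesis using assms by (auto simp: det_2)
next
  case False
  then have "(cmod (A$2$1))\<^sup>2 * (snd x)\<^sup>2 > 0" using assms by simp
  then show ?thesis by (simp add: add_nonneg_pos)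
qed

lemma sl_act_uminus: "sl_act (- A) x = sl_act A x"
proof -
  have *: "- (A$2$1 * fst x) - A$2$2 = - (A$2$1 * fst x + A$2$2)"
    "- (A$1$1 * fst x) - A$1$2 = - (A$1$1 * fst x + A$1$2)"
    by simp_all
  show ?thesis unfolding sl_act_eq
    by (simp add: * del: minus_add_distrib complex_cnj_add)
qed

lemma hyp_act_psl_of: "hyp_act (psl_of A) x = sl_act A x"
  by (simp add: hyp_act_def psl_of_eq sl_act_uminus)

lemma sl_act_upper: "det A = 1 \<Longrightarrow> x \<in> upper \<Longrightarrow> sl_act A x \<in> upper"
  using sl_denom_pos[of A x] by (simp add: sl_act_eq)

text \<open>The point \<open>(z, t)\<close> is encoded by a positive Hermitian matrix of determinant 1, on which
  a group element acts by \<open>X \<mapsto> A X A\<^sup>*\<close>.\<close>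

definition adjoint2 :: "complex^2^2 \<Rightarrow> complex^2^2" where
  "adjoint2 A = mat2 (cnj (A$1$1)) (cnj (A$2$1)) (cnj (A$1$2)) (cnj (A$2$2))"

definition herm :: "complex \<times> real \<Rightarrow> complex^2^2" where
  "herm x = mat2 (of_real ((cmod (fst x))\<^sup>2 + (snd x)\<^sup>2) / of_real (snd x))
    (fst x / of_real (snd x)) (cnj (fst x) / of_real (snd x)) (1 / of_real (snd x))"

lemma adjoint2_mult: "adjoint2 (A ** B) = adjoint2 B ** adjoint2 A"
  by (simp add: adjoint2_def matrix_2_eq_iff matrix_mult_2_nth mult.commute)

text \<open>The second column consists of \<open>z / t\<close> and \<open>1 / t\<close>, from which
  the point can be read off.\<close>

lemma herm_inject: "x \<in> upper \<Longrightarrow> y \<in> upper \<Longrightarrow> herm x = herm y \<Longrightarrow> x = y"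
  by (auto simp: herm_def matrix_2_eq_iff prod_eq_iff)

text \<open>Entries are compared over the real denominator \<open>N\<close>. Only the upper left one
  needs more than rearranging, namely the cancellation \<open>key\<close>.\<close>

lemma herm_sl_act:
  assumes "det A = 1" "x \<in> upper"
  shows "herm (sl_act A x) = A ** herm x ** adjoint2 A"
proof -
  obtain z t where x: "x = (z, t)" by (cases x)
  obtain a b c d where A: "a = A$1$1" "b = A$1$2" "c = A$2$1" "d = A$2$2" by simp
  have det: "a * d - b * c = 1" using assms by (simp add: det_2 A)
  have cdet: "cnj a * cnj d - cnj b * cnj c = 1" using arg_cong[OF det, of cnj] by simp
  define N where "N = (of_real (sl_denom A x) :: complex)"
  have N: "N = (c * z + d) * cnj (c * z + d) + c * cnj c * (of_real t)\<^sup>2"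
    by (simp only: N_def A x complex_norm_square of_real_add of_real_mult of_real_power[of t] fst_conv snd_conv)
  have N0: "N \<noteq> 0" using sl_denom_pos[OF assms] unfolding N_def of_real_eq_0_iff by linarith
  have t: "t > 0" using assms x by simp
  define T where "T = (of_real t :: complex)"
  have T0: "T \<noteq> 0" using t by (simp add: T_def)
  define Z where "Z = (a * z + b) * cnj (c * z + d) + a * cnj c * T\<^sup>2"
  have cN: "cnj N = N" by (simp add: N_def)
  have act: "fst (sl_act A x) = Z / N" "of_real (snd (sl_act A x)) = T / N"
    by (simp_all add: sl_act_eq N_def Z_def T_def A x)
  have cT: "cnj T = T" by (simp add: T_def)
  have sq: "of_real ((cmod w)\<^sup>2) = w * cnj w" for w by (rule complex_norm_square)
  have key: "Z * cnj Z + T\<^sup>2 = N * ((a * z + b) * cnj (a * z + b) + a * cnj a * T\<^sup>2)"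
  proof -
    \<comment> \<open>This becomes a polynomial identity once \<open>T^2\<close> carries the factor
      \<open>det A\<close> times its conjugate, which is 1.\<close>
    have "Z * cnj Z + T\<^sup>2 * ((a * d - b * c) * (cnj a * cnj d - cnj b * cnj c))
        = N * ((a * z + b) * cnj (a * z + b) + a * cnj a * T\<^sup>2)"
      by (simp add: Z_def N cT flip: T_def) algebra
    then show ?thesis by (simp add: det cdet)
  qed
  have 1: "(of_real ((cmod (fst (sl_act A x)))\<^sup>2 + (snd (sl_act A x))\<^sup>2) :: complex) =
     (Z * cnj Z + T\<^sup>2) / N\<^sup>2"
    unfolding of_real_add sq of_real_power[of "snd (sl_act A x)"] act
    by (simp add: cN power2_eq_square field_simps N0)
  have cnj_fst: "cnj (fst (sl_act A x)) = cnj Z / N"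
    by (simp add: act cN)
  have "herm (sl_act A x) = mat2 (((Z * cnj Z + T\<^sup>2) / N\<^sup>2) / (T / N)) ((Z / N) / (T / N))
      ((cnj Z / N) / (T / N)) (1 / (T / N))"
    unfolding herm_def 1 cnj_fst unfolding act ..
  also have "\<dots> = mat2 (((a * z + b) * cnj (a * z + b) + a * cnj a * T\<^sup>2) / T) (Z / T)
      (cnj Z / T) (N / T)"
    unfolding key using N0 T0 by (simp add: power2_eq_square)
  finally have L: "herm (sl_act A x) = \<dots>" .
  have R: "herm x = mat2 ((z * cnj z + T\<^sup>2) / T) (z / T) (cnj z / T) (1 / T)"
    unfolding herm_def x fst_conv snd_conv of_real_add sq T_def of_real_power[of t] ..
  show ?thesis
    unfolding L R
    by (simp only: matrix_2_eq_iff adjoint2_def matrix_mult_2_nth mat2_nth Z_def N flip: A T_def)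
      (simp add: cT T0 field_simps power2_eq_square)
qed

text \<open>Under the injection \<open>herm\<close> both sides become
  \<open>(A ** B) ** herm x ** adjoint2 (A ** B)\<close>, so associativity of the matrix product
  suffices.\<close>

lemma sl_act_mult:
  assumes "det A = 1" "det B = 1" "x \<in> upper"
  shows "sl_act (A ** B) x = sl_act A (sl_act B x)"
proof (rule herm_inject)
  have AB: "det (A ** B) = 1" using assms by (simp add: det_mul)
  show "sl_act (A ** B) x \<in> upper" "sl_act A (sl_act B x) \<in> upper"
    by (intro sl_act_upper assms AB)+
  show "herm (sl_act (A ** B) x) = herm (sl_act A (sl_act B x))"
    using assms sl_act_upper[OF assms(2,3)]
    by (simp add: herm_sl_act AB adjoint2_mult matrix_mul_assoc)
qed

lemma hyp_act_upper: "g \<in> carrier PSL2 \<Longrightarrow> x \<in> upper \<Longrightarrow> hyp_act g x \<in> upper"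
  unfolding carrier_PSL2 by (auto simp only: hyp_act_psl_of mem_Collect_eq dest: sl_act_upper[simplified])

lemma hyp_act_mult:
  assumes "g \<in> carrier PSL2" "h \<in> carrier PSL2" "x \<in> upper"
  shows "hyp_act (g \<otimes>\<^bsub>PSL2\<^esub> h) x = hyp_act g (hyp_act h x)"
  using assms by (auto simp: carrier_PSL2 psl_of_mult hyp_act_psl_of sl_act_mult)

lemma hyp_act_one: "hyp_act \<one>\<^bsub>PSL2\<^esub> x = x"
  by (cases x) (simp add: one_PSL2 hyp_act_psl_of sl_act_eq)

lemma hyp_act_inv:
  assumes "g \<in> carrier PSL2" "x \<in> upper"
  shows "hyp_act (inv\<^bsub>PSL2\<^esub> g) (hyp_act g x) = x" "hyp_act g (hyp_act (inv\<^bsub>PSL2\<^esub> g) x) = x"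
  using assms by (simp_all add: hyp_act_one flip: hyp_act_mult)

lemma inj_on_hyp_act: "g \<in> carrier PSL2 \<Longrightarrow> inj_on (hyp_act g) upper"
  by (rule inj_on_inverseI[where g = "hyp_act (inv\<^bsub>PSL2\<^esub> g)"]) (rule hyp_act_inv(1))


section \<open>Geodesics and horospheres\<close>

text \<open>Here \<open>u\<close> is the position along the chord. The horizontal distance to the
  midpoint is \<open>|1/2 - u|\<close> times the chord length, so the Pythagorean theorem turns the
  semicircle into an equation for \<open>t^2\<close>.\<close>

lemma ideal_geodesic_Fin_iff:
  "(z, t) \<in> ideal_geodesic (Fin w) (Fin w') \<longleftrightarrow>
    t > 0 \<and> (\<exists>u. 0 \<le> u \<and> u \<le> 1 \<and> z = (1 - u) *\<^sub>R w + u *\<^sub>R w' \<and>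
      t\<^sup>2 = u * (1 - u) * (cmod (w - w'))\<^sup>2)"
proof -
  have "dist (z, t) (midpoint w w', 0) = dist w w' / 2 \<longleftrightarrow>
      t\<^sup>2 = u * (1 - u) * (cmod (w - w'))\<^sup>2" (is "?l = ?r \<longleftrightarrow> _")
    if z: "z = (1 - u) *\<^sub>R w + u *\<^sub>R w'" for u
  proof -
    have "z - midpoint w w' = (1 / 2 - u) *\<^sub>R (w - w')"
      by (simp add: z midpoint_def complex_eq_iff algebra_simps)
    then have m: "(dist z (midpoint w w'))\<^sup>2 = (1 / 2 - u)\<^sup>2 * (cmod (w - w'))\<^sup>2"
      by (simp add: dist_norm power_mult_distrib)
    have "?l = ?r \<longleftrightarrow> ?l\<^sup>2 = ?r\<^sup>2"
      using power_eq_iff_eq_base[of 2 ?l ?r] by simp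
    also have "?l\<^sup>2 = (1 / 2 - u)\<^sup>2 * (cmod (w - w'))\<^sup>2 + t\<^sup>2"
      by (simp add: dist_Pair_Pair m)
    also have "?r\<^sup>2 = (cmod (w - w'))\<^sup>2 / 4"
      by (simp add: dist_norm power_divide)
    finally show ?thesis by (auto simp: power2_eq_square field_simps)
  qed
  then show ?thesis by (auto simp: closed_segment_def)
qed

text \<open>The endpoints are \<open>a / c\<close> and \<open>b / d\<close>, so a vanishing
  \<open>c\<close> or \<open>d\<close> gives a vertical line; otherwise the image is a semicircle,
  parametrized by the position on its chord. Treating one geodesic suffices, as the others enter
  below as its images.\<close>

lemma sl_act_geodesic:
  assumes det: "det A = 1"
  shows "sl_act A ` ideal_geodesic Infinity (Fin 0) =
    ideal_geodesic (sl_boundary_act A Infinity) (sl_boundary_act A (Fin 0))"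
proof -
  obtain a b c d where A: "a = A$1$1" "b = A$1$2" "c = A$2$1" "d = A$2$2" by simp
  have ad: "a * d - b * c = 1" using det by (simp add: det_2 A)
  have base: "ideal_geodesic Infinity (Fin 0) = Pair 0 ` {0<..}" by auto
  define N where "N t = (cmod d)\<^sup>2 + (cmod c)\<^sup>2 * t\<^sup>2" for t :: real
  have act: "sl_act A (0, t) = ((b * cnj d + a * cnj c * of_real (t\<^sup>2)) / of_real (N t), t / N t)" for t
    by (simp add: sl_act_eq N_def flip: A)
  have sq: "x * cnj y = (x / y) * of_real ((cmod y)\<^sup>2)" if "y \<noteq> 0" for x y
    using that unfolding complex_norm_square by simp
  consider "c = 0" "d \<noteq> 0" | "c \<noteq> 0" "d = 0" | "c \<noteq> 0" "d \<noteq> 0" using ad by (cases "c = 0"; cases "d = 0") auto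
  then show ?thesis
  proof cases
    case 1
    have *: "sl_act A (0, t) = (b / d, t / (cmod d)\<^sup>2)" for t
      using 1 unfolding act by (simp add: N_def sq)
    have "sl_act A ` Pair 0 ` {0<..} = Pair (b / d) ` {0<..}"
    proof (intro equalityI subsetI)
      fix x :: "complex \<times> real" assume "x \<in> Pair (b / d) ` {0<..}"
      then obtain t where "x = (b / d, t)" "t > 0" by auto
      then show "x \<in> sl_act A ` Pair 0 ` {0<..}"
        using 1 by (intro image_eqI[of _ _ "(0, t * (cmod d)\<^sup>2)"]) (auto simp: *)
    qed (use 1 in \<open>auto simp: *\<close>)
    then show ?thesis using 1 unfolding base by (auto simp flip: A)
  next
    case 2
    have *: "sl_act A (0, t) = (a / c, 1 / ((cmod c)\<^sup>2 * t))" if "t > 0" for t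
      using 2 that unfolding act by (simp add: N_def sq power2_eq_square)
    have "sl_act A ` Pair 0 ` {0<..} = Pair (a / c) ` {0<..}"
    proof (intro equalityI subsetI)
      fix x :: "complex \<times> real" assume "x \<in> Pair (a / c) ` {0<..}"
      then obtain t where "x = (a / c, t)" "t > 0" by auto
      then show "x \<in> sl_act A ` Pair 0 ` {0<..}"
        using 2 by (intro image_eqI[of _ _ "(0, 1 / ((cmod c)\<^sup>2 * t))"]) (auto simp: *)
    qed (use 2 in \<open>auto simp: *\<close>)
    then show ?thesis using 2 unfolding base by (auto simp flip: A)
  next
    case 3
    \<comment> \<open>The squared chord length; the determinant condition makes the difference of
      the endpoints \<open>1 / (c * d)\<close>.\<close>
    have L: "(cmod (a / c - b / d))\<^sup>2 = 1 / ((cmod c)\<^sup>2 * (cmod d)\<^sup>2)"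
    proof -
      have "a / c - b / d = 1 / (c * d)" using 3 ad by (simp add: field_simps)
      then show ?thesis by (simp add: norm_divide norm_mult power_divide power_mult_distrib)
    qed
    have N0: "N t > 0" for t unfolding N_def using 3 by (simp add: add_pos_nonneg)
    \<comment> \<open>The chord position of the image of \<open>(0, t)\<close> is
      \<open>u = |d|^2 / N t\<close>.\<close>
    have eq: "fst (sl_act A (0, t)) =
        (1 - (cmod d)\<^sup>2 / N t) *\<^sub>R (a / c) + ((cmod d)\<^sup>2 / N t) *\<^sub>R (b / d)" for t
    proof -
      have "1 - (cmod d)\<^sup>2 / N t = (cmod c)\<^sup>2 * t\<^sup>2 / N t"
        using N0[of t] by (simp add: N_def field_simps)
      moreover have "fst (sl_act A (0, t)) = (b / d * of_real ((cmod d)\<^sup>2) +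
          a / c * of_real ((cmod c)\<^sup>2) * of_real (t\<^sup>2)) / of_real (N t)"
        using 3 sq[of d b] sq[of c a] by (simp add: act)
      ultimately show ?thesis by (simp add: scaleR_conv_of_real add_divide_distrib mult_ac)
    qed
    have "sl_act A ` Pair 0 ` {0<..} = ideal_geodesic (Fin (a / c)) (Fin (b / d))"
    proof (intro equalityI subsetI)
      fix x assume "x \<in> sl_act A ` Pair 0 ` {0<..}"
      then obtain t where t: "t > 0" and x: "x = sl_act A (0, t)" by auto
      let ?u = "(cmod d)\<^sup>2 / N t"
      have "0 \<le> ?u" "?u \<le> 1" using N0[of t] by (auto simp: N_def)
      moreover have "(t / N t)\<^sup>2 = ?u * (1 - ?u) * (cmod (a / c - b / d))\<^sup>2"
      proof -
        have "1 - ?u = (cmod c)\<^sup>2 * t\<^sup>2 / N t"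
          using N0[of t] by (simp add: N_def field_simps)
        then show ?thesis unfolding L using 3 by (simp add: power2_eq_square)
      qed
      moreover have "x = (fst x, t / N t)" "t / N t > 0" using t N0[of t] by (simp_all add: x act)
      ultimately show "x \<in> ideal_geodesic (Fin (a / c)) (Fin (b / d))"
        using eq[of t] ideal_geodesic_Fin_iff[of "fst x" "t / N t" "a / c" "b / d"] x by auto
    next
      fix x assume "x \<in> ideal_geodesic (Fin (a / c)) (Fin (b / d))"
      moreover obtain z t where x: "x = (z, t)" by (cases x)
      ultimately obtain u where t: "t > 0" and u: "0 \<le> u" "u \<le> 1"
        and z: "z = (1 - u) *\<^sub>R (a / c) + u *\<^sub>R (b / d)"
        and t2: "t\<^sup>2 = u * (1 - u) * (cmod (a / c - b / d))\<^sup>2"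
        using ideal_geodesic_Fin_iff by blast
      have u0: "u > 0" using t t2 u by (cases "u = 0") auto
      \<comment> \<open>The height of the preimage, solved from \<open>u = |d|^2 / N s\<close> and
        \<open>t = s / N s\<close>.\<close>
      define s where "s = t * (cmod d)\<^sup>2 / u"
      have s0: "s > 0" using t u0 3 by (simp add: s_def)
      have "s\<^sup>2 = t\<^sup>2 * (cmod d)^4 / u\<^sup>2"
        by (simp add: s_def power_mult_distrib power_divide)
      also have "\<dots> = (1 - u) / u * (cmod d)\<^sup>2 / (cmod c)\<^sup>2"
        unfolding t2 L using u0 3 by (simp add: power2_eq_square power4_eq_xxxx)
      finally have "(cmod c)\<^sup>2 * s\<^sup>2 = (1 - u) / u * (cmod d)\<^sup>2" using 3 by simp
      then have Ns: "N s = (cmod d)\<^sup>2 / u" using u0 by (simp add: N_def field_simps)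
      have "sl_act A (0, s) = x"
        unfolding x prod_eq_iff eq z using 3 u0 by (simp add: act Ns) (simp add: s_def)
      then show "x \<in> sl_act A ` Pair 0 ` {0<..}" using s0 by force
    qed
    then show ?thesis using 3 unfolding base by (simp flip: A)
  qed
qed

lemma hyp_act_geodesic:
  assumes "g \<in> carrier PSL2"
  shows "hyp_act g ` ideal_geodesic Infinity (Fin 0) =
    ideal_geodesic (boundary_act g Infinity) (boundary_act g (Fin 0))"
proof -
  obtain A where A: "det A = 1" "g = psl_of A" using assms by (auto simp: carrier_PSL2)
  have "hyp_act g = sl_act A" by (rule ext) (simp add: A hyp_act_psl_of)
  then show ?thesis using sl_act_geodesic[OF A(1)] by (simp add: A boundary_act_psl_of)
qed

section \<open>Horospheres as images of horizontal planes\<close>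

abbreviation level :: "real \<Rightarrow> (complex \<times> real) set" where
  "level h \<equiv> {x. snd x = h}"

lemma hyp_act_level:
  assumes "g \<in> carrier PSL2" "h > 0"
  shows "hyp_act g ` level h = {y \<in> upper. snd (hyp_act (inv\<^bsub>PSL2\<^esub> g) y) = h}"
proof (intro equalityI subsetI)
  fix y assume "y \<in> hyp_act g ` level h"
  then obtain x where "y = hyp_act g x" "snd x = h" "x \<in> upper" using assms by auto
  then show "y \<in> {y \<in> upper. snd (hyp_act (inv\<^bsub>PSL2\<^esub> g) y) = h}"
    using assms hyp_act_upper[of g x] by (simp add: hyp_act_inv)
next
  fix y assume "y \<in> {y \<in> upper. snd (hyp_act (inv\<^bsub>PSL2\<^esub> g) y) = h}"
  then show "y \<in> hyp_act g ` level h"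
    using assms hyp_act_inv(2)[of g y] by (intro image_eqI[of _ _ "hyp_act (inv\<^bsub>PSL2\<^esub> g) y"]) auto
qed

text \<open>The sphere equation forces \<open>t \<ge> 0\<close>, and at \<open>t = 0\<close> it
  leaves only the point of tangency; removing that point therefore amounts to requiring positive
  height.\<close>

lemma sphere_minus_point:
  assumes "r > 0"
  shows "sphere (w, r) r - {(w, 0)} = {(z, t). t > 0 \<and> (cmod (z - w))\<^sup>2 + t\<^sup>2 = 2 * r * t}"
proof -
  have "dist (w, r) (z, t) = r \<longleftrightarrow> (cmod (z - w))\<^sup>2 + t\<^sup>2 = 2 * r * t" for z :: complex and t :: real
  proof -
    have "dist (w, r) (z, t) = r \<longleftrightarrow> (dist (w, r) (z, t))\<^sup>2 = r\<^sup>2"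
      using assms power_eq_iff_eq_base[of 2 "dist (w, r) (z, t)" r] by simp
    also have "(dist (w, r) (z, t))\<^sup>2 = (cmod (z - w))\<^sup>2 + (r - t)\<^sup>2"
      by (simp add: dist_Pair_Pair dist_norm[of w z] dist_real_def norm_minus_commute[of w z])
    also have "\<dots> = r\<^sup>2 \<longleftrightarrow> (cmod (z - w))\<^sup>2 + t\<^sup>2 = 2 * r * t"
      by (auto simp: power2_eq_square algebra_simps)
    finally show ?thesis .
  qed
  moreover have "t > 0 \<longleftrightarrow> (z, t) \<noteq> (w, 0)" if "(cmod (z - w))\<^sup>2 + t\<^sup>2 = 2 * r * t" for z t
  proof -
    have "2 * r * t \<ge> 0" using that by (metis sum_power2_ge_zero)
    then have "t \<ge> 0" using assms by (simp add: zero_le_mult_iff)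
    then show ?thesis using that by (cases "t = 0") auto
  qed
  ultimately show ?thesis by auto
qed

text \<open>Membership in the image of a plane is read off from the height of the preimage. If
  \<open>c = 0\<close>, planes are rescaled by \<open>|a|^2\<close>; otherwise the height equation
  describes the sphere tangent at \<open>a / c\<close> of radius
  \<open>1 / (2 h |c|^2)\<close>.\<close>

lemma horosphere_iff:
  assumes "g \<in> carrier PSL2"
  shows "horosphere (boundary_act g Infinity) H \<longleftrightarrow> (\<exists>h > 0. H = hyp_act g ` level h)"
proof -
  obtain A where A: "det A = 1" "g = psl_of A" using assms by (auto simp: carrier_PSL2)
  obtain a b c d where M: "a = A$1$1" "b = A$1$2" "c = A$2$1" "d = A$2$2" by simp
  have ad: "a * d - b * c = 1" using A by (simp add: det_2 M)
  have inv: "snd (hyp_act (inv\<^bsub>PSL2\<^esub> g) (z, t)) = t / ((cmod (a - c * z))\<^sup>2 + (cmod c)\<^sup>2 * t\<^sup>2)"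
    for z t
    using A by (simp add: inv_psl_of hyp_act_psl_of sl_act_eq flip: M)
  show ?thesis
  proof (cases "c = 0")
    case True
    then have a: "a \<noteq> 0" using ad by auto
    have *: "hyp_act g ` level h = level (h * (cmod a)\<^sup>2)" if "h > 0" for h
    proof -
      have "h * (cmod a)\<^sup>2 > 0" using that a by simp
      then show ?thesis
        unfolding hyp_act_level[OF assms that] using True a by (auto simp: inv field_simps)
    qed
    have "horosphere (boundary_act g Infinity) H \<longleftrightarrow> (\<exists>h > 0. H = level h)"
      using True by (simp add: A boundary_act_psl_of M case_prod_unfold)
    also have "\<dots> \<longleftrightarrow> (\<exists>h > 0. H = level (h * (cmod a)\<^sup>2))"
    proof
      assume "\<exists>h>0. H = level h"
      then obtain h where "h > 0" "H = level h" by blast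
      then show "\<exists>h>0. H = level (h * (cmod a)\<^sup>2)"
        using a by (intro exI[of _ "h / (cmod a)\<^sup>2"]) simp
    next
      assume "\<exists>h>0. H = level (h * (cmod a)\<^sup>2)"
      then obtain h where "h > 0" "H = level (h * (cmod a)\<^sup>2)" by blast
      then show "\<exists>h>0. H = level h"
        using a by (intro exI[of _ "h * (cmod a)\<^sup>2"]) simp
    qed
    finally show ?thesis by (simp add: * cong: conj_cong)
  next
    case False
    have *: "hyp_act g ` level h = sphere (a / c, r) r - {(a / c, 0)}"
      if h: "h > 0" and r: "r = 1 / (2 * h * (cmod c)\<^sup>2)" for h r
    proof -
      have r0: "r > 0" using h False by (simp add: r)
      have height: "t / ((cmod (a - c * z))\<^sup>2 + (cmod c)\<^sup>2 * t\<^sup>2) = h \<longleftrightarrow>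
          (cmod (z - a / c))\<^sup>2 + t\<^sup>2 = 2 * r * t" if t: "t > 0" for z t
      proof -
        have "a - c * z = - c * (z - a / c)" using False by (simp add: field_simps)
        then have "(cmod (a - c * z))\<^sup>2 = (cmod c)\<^sup>2 * (cmod (z - a / c))\<^sup>2"
          by (simp add: norm_mult power_mult_distrib)
        moreover have "(cmod (z - a / c))\<^sup>2 + t\<^sup>2 > 0" using t by (simp add: add_nonneg_pos)
        moreover have "t / (C * Q) = h \<longleftrightarrow> Q = t / (h * C)" if "C > 0" "Q > 0" for C Q
          using that h by (simp add: divide_eq_eq eq_divide_eq mult_ac) auto
        moreover have "2 * r * t = t / (h * (cmod c)\<^sup>2)" by (simp add: r)
        ultimately show ?thesis using False by (simp flip: distrib_left)
      qed
      show ?thesis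
        unfolding hyp_act_level[OF assms h] sphere_minus_point[OF r0]
      proof (rule Set.set_eqI)
        fix x :: "complex \<times> real"
        show "x \<in> {y \<in> upper. snd (hyp_act (inv\<^bsub>PSL2\<^esub> g) y) = h} \<longleftrightarrow>
            x \<in> {(z, t). t > 0 \<and> (cmod (z - a / c))\<^sup>2 + t\<^sup>2 = 2 * r * t}"
          by (cases x) (simp add: inv height cong: conj_cong)
      qed
    qed
    have "horosphere (boundary_act g Infinity) H \<longleftrightarrow>
        (\<exists>r > 0. H = sphere (a / c, r) r - {(a / c, 0)})"
      using False by (simp add: A boundary_act_psl_of flip: M)
    also have "\<dots> \<longleftrightarrow> (\<exists>h > 0. H = hyp_act g ` level h)"
    proof
      assume "\<exists>r > 0. H = sphere (a / c, r) r - {(a / c, 0)}"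
      then obtain r where r: "r > 0" "H = sphere (a / c, r) r - {(a / c, 0)}" by blast
      \<comment> \<open>The relation between radius and height is symmetric, so the same formula
        inverts it.\<close>
      define h where "h = 1 / (2 * r * (cmod c)\<^sup>2)"
      have "h > 0" "r = 1 / (2 * h * (cmod c)\<^sup>2)" using r False by (simp_all add: h_def)
      then show "\<exists>h > 0. H = hyp_act g ` level h" using r(2) * by blast
    next
      assume "\<exists>h > 0. H = hyp_act g ` level h"
      then obtain h where h: "h > 0" "H = hyp_act g ` level h" by blast
      moreover have "1 / (2 * h * (cmod c)\<^sup>2) > 0" using h False by simp
      ultimately show "\<exists>r > 0. H = sphere (a / c, r) r - {(a / c, 0)}" using * by blast
    qed
    finally show ?thesis .
  qed
qed

section \<open>Isometry of the action\<close>

text \<open>Preservation of the hyperbolic metric tensor, expressed by norms of derivatives because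
  \<open>ehorospheres\<close> states its metric condition in that form.\<close>

definition infinitesimal_isometry :: "(complex \<times> real \<Rightarrow> complex \<times> real) \<Rightarrow> bool" where
  "infinitesimal_isometry f \<longleftrightarrow> (\<forall>x \<in> upper. f x \<in> upper \<and>
     (\<exists>L. (f has_derivative L) (at x) \<and> (\<forall>v. norm (L v) / snd (f x) = norm v / snd x)))"

lemma open_upper: "open upper"
  by (intro open_Collect_less continuous_intros)

text \<open>Chain rule. As \<open>sl_act_mult\<close> speaks of points of \<open>upper\<close>, the
  derivative is transferred using that \<open>upper\<close> is open.\<close>

lemma infinitesimal_isometry_sl_act_mult:
  assumes "det A = 1" "det B = 1"
    and "infinitesimal_isometry (sl_act A)" "infinitesimal_isometry (sl_act B)"
  shows "infinitesimal_isometry (sl_act (A ** B))"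
  unfolding infinitesimal_isometry_def
proof
  fix x assume x: "x \<in> upper"
  obtain M where Bx: "sl_act B x \<in> upper" and M: "(sl_act B has_derivative M) (at x)"
    "\<And>v. norm (M v) / snd (sl_act B x) = norm v / snd x"
    using assms(4) x unfolding infinitesimal_isometry_def by blast
  obtain L where ABx: "sl_act A (sl_act B x) \<in> upper"
    and L: "(sl_act A has_derivative L) (at (sl_act B x))"
    "\<And>v. norm (L v) / snd (sl_act A (sl_act B x)) = norm v / snd (sl_act B x)"
    using assms(3) Bx unfolding infinitesimal_isometry_def by blast
  have "((\<lambda>y. sl_act A (sl_act B y)) has_derivative (\<lambda>v. L (M v))) (at x)"
    by (rule has_derivative_compose[OF M(1) L(1)])
  then have "(sl_act (A ** B) has_derivative (\<lambda>v. L (M v))) (at x)"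
    by (rule has_derivative_transform_within_open[OF _ open_upper x])
      (rule sl_act_mult[OF assms(1,2), symmetric])
  moreover have "sl_act (A ** B) x = sl_act A (sl_act B x)"
    by (rule sl_act_mult[OF assms(1,2) x])
  ultimately show "sl_act (A ** B) x \<in> upper \<and> (\<exists>L. (sl_act (A ** B) has_derivative L) (at x) \<and>
      (\<forall>v. norm (L v) / snd (sl_act (A ** B) x) = norm v / snd x))"
    using ABx L(2) M(2) by (intro conjI exI[of _ "\<lambda>v. L (M v)"]) auto
qed

text \<open>A Euclidean similarity, because \<open>d = 1 / a\<close>: horizontally a multiplication
  by \<open>a^2\<close> and a shift, vertically a scaling by the modulus of
  \<open>a^2\<close>.\<close>

lemma sl_act_upper_triangular:
  assumes "a * d = 1"
  shows "sl_act (mat2 a b 0 d) x = (a\<^sup>2 * fst x + a * b, (cmod a)\<^sup>2 * snd x)"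
proof -
  have d: "d = 1 / a" "a \<noteq> 0" using assms by (auto simp: eq_divide_eq mult.commute)
  have "(a * fst x + b) * cnj d / of_real ((cmod d)\<^sup>2) = (a * fst x + b) * a"
    unfolding complex_norm_square using d by simp
  then show ?thesis
    using d by (simp add: sl_act_eq norm_divide power_divide algebra_simps power2_eq_square)
qed

lemma infinitesimal_isometry_upper_triangular:
  assumes "a * d = 1"
  shows "infinitesimal_isometry (sl_act (mat2 a b 0 d))"
  unfolding infinitesimal_isometry_def
proof
  fix x assume x: "x \<in> upper"
  have a: "a \<noteq> 0" using assms by auto
  let ?L = "\<lambda>v. (a\<^sup>2 * fst v, (cmod a)\<^sup>2 * snd v)"
  have "(sl_act (mat2 a b 0 d) has_derivative ?L) (at x)"
    unfolding sl_act_upper_triangular[OF assms, abs_def]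
    by (auto intro!: derivative_eq_intros)
  moreover have "norm (?L v) = (cmod a)\<^sup>2 * norm v" for v
  proof -
    have "norm (?L v) = sqrt ((cmod a)^4 * ((cmod (fst v))\<^sup>2 + (snd v)\<^sup>2))"
      by (simp add: norm_Pair norm_mult norm_power power_mult_distrib distrib_left)
    also have "\<dots> = (cmod a)\<^sup>2 * norm v"
      using real_sqrt_abs[of "(cmod a)\<^sup>2"] by (simp add: real_sqrt_mult norm_prod_def)
    finally show ?thesis .
  qed
  ultimately show "sl_act (mat2 a b 0 d) x \<in> upper \<and>
      (\<exists>L. (sl_act (mat2 a b 0 d) has_derivative L) (at x) \<and>
        (\<forall>v. norm (L v) / snd (sl_act (mat2 a b 0 d) x) = norm v / snd x))"
    using x a unfolding sl_act_upper_triangular[OF assms]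
    by (intro conjI exI[of _ ?L]) (auto simp: sl_act_upper_triangular[OF assms])
qed

text \<open>The map is inversion in the unit sphere followed by the reflection \<open>R\<close>. The
  derivative of the inversion at \<open>x\<close> is a reflection divided by
  \<open>x \<bullet> x\<close>, and the height is divided by the same number.\<close>

lemma infinitesimal_isometry_inversion: "infinitesimal_isometry (sl_act (mat2 0 (-1) 1 0))"
  unfolding infinitesimal_isometry_def
proof
  fix x assume x: "x \<in> upper"
  define R where "R = (\<lambda>v :: complex \<times> real. (- cnj (fst v), snd v))"
  have R: "bounded_linear R" unfolding R_def linear_conv_bounded_linear[symmetric]
    by (rule linearI) (auto simp: scaleR_conv_of_real)
  have nR: "norm (R v) = norm v" for v by (simp add: R_def norm_prod_def)
  have inner: "v \<bullet> v = (cmod (fst v))\<^sup>2 + (snd v)\<^sup>2" for v :: "complex \<times> real"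
    by (cases v) (simp add: dot_square_norm norm_Pair)
  have act: "sl_act (mat2 0 (-1) 1 0) v = inverse (v \<bullet> v) *\<^sub>R R v" for v
    by (simp add: sl_act_eq R_def inner scaleR_conv_of_real divide_simps)
  have x0: "x \<bullet> x > 0" using x by auto
  let ?L = "\<lambda>v. inverse (x \<bullet> x) *\<^sub>R R v - (2 * (x \<bullet> v) * (inverse (x \<bullet> x))\<^sup>2) *\<^sub>R R x"
  have "((\<lambda>v. inverse (v \<bullet> v) *\<^sub>R R v) has_derivative ?L) (at x)"
    by (auto intro!: derivative_eq_intros bounded_linear.has_derivative[OF R] ext x0[THEN less_imp_neq, symmetric]
      simp: power2_eq_square inner_commute algebra_simps)
  then have "(sl_act (mat2 0 (-1) 1 0) has_derivative ?L) (at x)" unfolding act[abs_def] .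
  moreover have "norm (?L v) = norm v / (x \<bullet> x)" for v
  proof -
    \<comment> \<open>Up to the factor \<open>inverse (x \<bullet> x)\<close>, this is
      \<open>v\<close> reflected in the hyperplane orthogonal to \<open>x\<close>, so its norm is
      known.\<close>
    let ?y = "inverse (x \<bullet> x) *\<^sub>R v - (2 * (x \<bullet> v) * (inverse (x \<bullet> x))\<^sup>2) *\<^sub>R x"
    have "?L v = R ?y"
      by (simp add: linear_diff linear_scale bounded_linear.linear[OF R])
    moreover have y: "?y \<bullet> ?y = (v \<bullet> v) * (inverse (x \<bullet> x))\<^sup>2"
      using x0 by (simp add: inner_diff_left inner_diff_right inner_commute power2_eq_square field_simps)
    have "norm ?y = norm v / (x \<bullet> x)"
      unfolding norm_eq_sqrt_inner y real_sqrt_mult using x0 by (simp add: divide_inverse)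
    ultimately show ?thesis by (simp only: nR)
  qed
  moreover have "snd (sl_act (mat2 0 (-1) 1 0) x) = snd x / (x \<bullet> x)"
    by (simp add: act R_def field_simps)
  ultimately show "sl_act (mat2 0 (-1) 1 0) x \<in> upper \<and>
      (\<exists>L. (sl_act (mat2 0 (-1) 1 0) has_derivative L) (at x) \<and>
        (\<forall>v. norm (L v) / snd (sl_act (mat2 0 (-1) 1 0) x) = norm v / snd x))"
    using x x0 by (intro conjI exI[of _ ?L]) auto
qed

text \<open>Bruhat decomposition: a matrix which is not upper triangular is a product of two upper
  triangular ones and the inversion.\<close>

lemma infinitesimal_isometry_sl_act:
  assumes det: "det A = 1"
  shows "infinitesimal_isometry (sl_act A)"
proof -
  obtain a b c d where A: "A = mat2 a b c d"
    by (metis matrix_2_eq_iff mat2_nth)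
  have ad: "a * d - b * c = 1" using det by (simp add: A)
  show ?thesis
  proof (cases "c = 0")
    case True
    then show ?thesis using ad infinitesimal_isometry_upper_triangular[of a d b] by (simp add: A)
  next
    case False
    have "A = mat2 (1 / c) a 0 c ** (mat2 0 (-1) 1 0 ** mat2 1 (d / c) 0 1)"
      using False ad by (auto simp: A matrix_2_eq_iff matrix_mult_2_nth field_simps)
    then show ?thesis
      using False by (simp add: infinitesimal_isometry_sl_act_mult det_mul
        infinitesimal_isometry_upper_triangular infinitesimal_isometry_inversion)
  qed
qed

lemma infinitesimal_isometry_hyp_act:
  assumes "g \<in> carrier PSL2"
  shows "infinitesimal_isometry (hyp_act g)"
proof -
  obtain A where A: "det A = 1" "g = psl_of A" using assms by (auto simp: carrier_PSL2)
  have "hyp_act g = sl_act A" by (rule ext) (simp add: A hyp_act_psl_of)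
  then show ?thesis using infinitesimal_isometry_sl_act[OF A(1)] by simp
qed


section \<open>Euclidean horospheres as translates of a standard one\<close>

lemma boundary_act_transitive: "\<exists>g \<in> carrier PSL2. boundary_act g Infinity = v"
proof (cases v)
  case (Fin w)
  have "boundary_act (psl_of (mat2 w (- 1) 1 0)) Infinity = v"
    by (simp add: Fin boundary_act_psl_of)
  moreover have "psl_of (mat2 w (- 1) 1 0) \<in> carrier PSL2" by simp
  ultimately show ?thesis by blast
next
  case Infinity
  then show ?thesis using boundary_act_one by blast
qed

lemma horosphere_subset_upper: "horosphere v H \<Longrightarrow> H \<subseteq> upper"
proof -
  assume H: "horosphere v H"
  obtain g where g: "g \<in> carrier PSL2" "boundary_act g Infinity = v"
    using boundary_act_transitive by blast
  then obtain h where "h > 0" "H = hyp_act g ` level h" using H horosphere_iff[of g H] by blast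
  then show "H \<subseteq> upper" using hyp_act_level[OF g(1)] by auto
qed

lemma hyp_act_image_mult:
  assumes "g \<in> carrier PSL2" "h \<in> carrier PSL2" "H \<subseteq> upper"
  shows "hyp_act (g \<otimes>\<^bsub>PSL2\<^esub> h) ` H = hyp_act g ` hyp_act h ` H"
  unfolding image_image using assms by (intro image_cong) (auto simp: hyp_act_mult)

lemma horosphere_hyp_act:
  assumes "g \<in> carrier PSL2" "horosphere v H"
  shows "horosphere (boundary_act g v) (hyp_act g ` H)"
proof -
  obtain k where k: "k \<in> carrier PSL2" "boundary_act k Infinity = v"
    using boundary_act_transitive by blast
  then obtain h where h: "h > 0" "H = hyp_act k ` level h"
    using assms(2) horosphere_iff[of k H] by blast
  then have "hyp_act g ` H = hyp_act (g \<otimes>\<^bsub>PSL2\<^esub> k) ` level h"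
    using assms(1) k(1) by (subst hyp_act_image_mult) auto
  moreover have "boundary_act g v = boundary_act (g \<otimes>\<^bsub>PSL2\<^esub> k) Infinity"
    using assms(1) k by (simp add: boundary_act_mult)
  ultimately show ?thesis
    using horosphere_iff[of "g \<otimes>\<^bsub>PSL2\<^esub> k"] assms(1) k(1) h(1) by auto
qed

text \<open>The inverse of the new chart is \<open>hyp_act g\<close> after \<open>\<psi>\<close>.
  The metric condition follows by the chain rule, and the orientation condition for \<open>k\<close>
  is the old one for the product of the inverse of \<open>g\<close> with \<open>k\<close>.\<close>

lemma ehorosphere_act_mem:
  assumes g: "g \<in> carrier PSL2" and E: "E \<in> ehorospheres v"
  shows "ehorosphere_act g E \<in> ehorospheres (boundary_act g v)"
proof -
  obtain H \<phi> where E_eq: "E = (H, \<phi>)" by (cases E)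
  define \<psi> where "\<psi> = inv_into H \<phi>"
  have H: "horosphere v H" and bij: "bij_betw \<phi> H UNIV"
    and der: "\<And>w. \<exists>D. (\<psi> has_derivative D) (at w) \<and> (\<forall>\<xi>. norm (D \<xi>) / snd (\<psi> w) = norm \<xi>)"
    and ori: "\<And>k. k \<in> carrier PSL2 \<Longrightarrow> boundary_act k Infinity = v \<Longrightarrow>
      orientation_preserving (\<lambda>w. fst (hyp_act (inv\<^bsub>PSL2\<^esub> k) (\<psi> w)))"
    using E unfolding E_eq ehorospheres_def by (auto simp: Let_def \<psi>_def)
  have up: "H \<subseteq> upper" using horosphere_subset_upper[OF H] .
  have \<psi>: "\<psi> w \<in> H" "\<phi> (\<psi> w) = w" for w
    unfolding \<psi>_def using bij by (auto simp: bij_betw_def f_inv_into_f inv_into_into)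
  define H' where "H' = hyp_act g ` H"
  define \<phi>' where "\<phi>' = restrict (\<lambda>x. \<phi> (hyp_act (inv\<^bsub>PSL2\<^esub> g) x)) H'"
  have act: "ehorosphere_act g E = (H', \<phi>')"
    by (simp add: E_eq ehorosphere_act_def H'_def \<phi>'_def)
  have \<phi>': "\<phi>' (hyp_act g x) = \<phi> x" if "x \<in> H" for x
    using that up hyp_act_inv(1)[OF g, of x] by (auto simp: \<phi>'_def H'_def)
  have inj_g: "inj_on (hyp_act g) H"
    using inj_on_hyp_act[OF g] up by (rule inj_on_subset)
  have bij': "bij_betw \<phi>' H' UNIV"
    unfolding bij_betw_def
  proof
    show "inj_on \<phi>' H'"
      using bij by (auto simp: inj_on_def H'_def \<phi>' bij_betw_def)
    have "\<phi>' ` H' = \<phi> ` H" by (force simp: H'_def \<phi>')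
    then show "\<phi>' ` H' = UNIV" using bij by (simp add: bij_betw_def)
  qed
  have inv: "inv_into H' \<phi>' w = hyp_act g (\<psi> w)" for w
    by (rule inv_into_f_eq) (use bij' \<psi> \<phi>' in \<open>auto simp: bij_betw_def H'_def\<close>)
  have "\<exists>D. (inv_into H' \<phi>' has_derivative D) (at w) \<and>
      (\<forall>\<xi>. norm (D \<xi>) / snd (inv_into H' \<phi>' w) = norm \<xi>)" for w
  proof -
    obtain D where D: "(\<psi> has_derivative D) (at w)" "\<And>\<xi>. norm (D \<xi>) / snd (\<psi> w) = norm \<xi>"
      using der by blast
    have "\<psi> w \<in> upper" using \<psi> up by blast
    then obtain L where L: "(hyp_act g has_derivative L) (at (\<psi> w))"
      "\<And>v. norm (L v) / snd (hyp_act g (\<psi> w)) = norm v / snd (\<psi> w)"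
      using infinitesimal_isometry_hyp_act[OF g] unfolding infinitesimal_isometry_def by blast
    have "((\<lambda>w. hyp_act g (\<psi> w)) has_derivative (\<lambda>\<xi>. L (D \<xi>))) (at w)"
      by (rule has_derivative_compose[OF D(1) L(1)])
    then show ?thesis
      unfolding inv[abs_def] using L(2) D(2) by (intro exI[of _ "\<lambda>\<xi>. L (D \<xi>)"]) auto
  qed
  moreover have "orientation_preserving (\<lambda>w. fst (hyp_act (inv\<^bsub>PSL2\<^esub> k) (inv_into H' \<phi>' w)))"
    if k: "k \<in> carrier PSL2" "boundary_act k Infinity = boundary_act g v" for k
  proof -
    let ?k = "inv\<^bsub>PSL2\<^esub> g \<otimes>\<^bsub>PSL2\<^esub> k"
    have "hyp_act (inv\<^bsub>PSL2\<^esub> ?k) (\<psi> w) = hyp_act (inv\<^bsub>PSL2\<^esub> k) (inv_into H' \<phi>' w)" for w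
    proof -
      have "\<psi> w \<in> upper" using \<psi> up by blast
      then show ?thesis using g k(1) by (simp add: PSL2.inv_mult_group hyp_act_mult inv)
    qed
    moreover have "boundary_act ?k Infinity = v"
      using g k by (simp add: boundary_act_mult boundary_act_inv)
    ultimately show ?thesis using ori[of ?k] g k(1) by simp
  qed
  moreover have "horosphere (boundary_act g v) H'"
    unfolding H'_def by (rule horosphere_hyp_act[OF g H])
  ultimately show ?thesis
    unfolding act ehorospheres_def using bij' by (auto simp: Let_def \<phi>'_def)
qed

section \<open>Translation classes and the action on them\<close>

lemma translation_class:
  "translation_rel `` {(H, \<phi>)} = {(H, restrict (\<lambda>x. \<phi> x + c) H) | c. True}"
  by (auto simp: translation_rel_def)

text \<open>Translations form a group: the shift of \<open>X\<close> by \<open>e\<close> is the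
  shift of \<open>Y\<close> by \<open>e - c\<close>.\<close>

lemma translation_class_eqI:
  assumes "(X, Y) \<in> translation_rel"
  shows "translation_rel `` {X} = translation_rel `` {Y}"
proof -
  obtain H \<phi> c where X: "X = (H, \<phi>)" and Y: "Y = (H, restrict (\<lambda>x. \<phi> x + c) H)"
    using assms by (auto simp: translation_rel_def)
  have Y_class: "translation_rel `` {Y} = {(H, restrict (\<lambda>x. \<phi> x + (c + e)) H) | e. True}"
    unfolding Y translation_class by (auto simp: add.assoc cong: restrict_cong)
  have "(H, restrict (\<lambda>x. \<phi> x + e) H) \<in> translation_rel `` {Y}" for e
    unfolding Y_class by (auto intro!: exI[of _ "e - c"])
  then show ?thesis unfolding X Y_class translation_class by auto
qed

text \<open>Adding a constant to a chart commutes with precomposing it; the inner restriction is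
  harmless, as preimages of points of the moved horosphere lie in \<open>H\<close>.\<close>

lemma ehorosphere_act_class:
  assumes "g \<in> carrier PSL2" "H \<subseteq> upper"
  shows "ehorosphere_act g ` (translation_rel `` {(H, \<phi>)}) =
    translation_rel `` {ehorosphere_act g (H, \<phi>)}"
proof -
  have *: "ehorosphere_act g (H, restrict (\<lambda>x. \<phi> x + c) H) = (hyp_act g ` H,
      restrict (\<lambda>x. restrict (\<lambda>x. \<phi> (hyp_act (inv\<^bsub>PSL2\<^esub> g) x)) (hyp_act g ` H) x + c) (hyp_act g ` H))" for c
    using assms hyp_act_inv(1)[OF assms(1)] unfolding ehorosphere_act_def
    by (auto intro!: restrict_ext)
  have **: "ehorosphere_act g (H, \<phi>) =
      (hyp_act g ` H, restrict (\<lambda>x. \<phi> (hyp_act (inv\<^bsub>PSL2\<^esub> g) x)) (hyp_act g ` H))"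
    by (simp add: ehorosphere_act_def)
  have "ehorosphere_act g ` (translation_rel `` {(H, \<phi>)}) =
      {ehorosphere_act g (H, restrict (\<lambda>x. \<phi> x + c) H) | c. True}"
    unfolding translation_class by blast
  then show ?thesis unfolding * ** translation_class .
qed

lemma ehorosphere_act_mult:
  assumes "g \<in> carrier PSL2" "h \<in> carrier PSL2" "H \<subseteq> upper"
  shows "ehorosphere_act (g \<otimes>\<^bsub>PSL2\<^esub> h) (H, \<phi>) = ehorosphere_act g (ehorosphere_act h (H, \<phi>))"
proof -
  have "hyp_act (inv\<^bsub>PSL2\<^esub> (g \<otimes>\<^bsub>PSL2\<^esub> h)) x = hyp_act (inv\<^bsub>PSL2\<^esub> h) (hyp_act (inv\<^bsub>PSL2\<^esub> g) x) \<and>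
      hyp_act (inv\<^bsub>PSL2\<^esub> g) x \<in> hyp_act h ` H"
    if x: "x \<in> hyp_act g ` hyp_act h ` H" for x
  proof -
    obtain y where y: "y \<in> H" "x = hyp_act g (hyp_act h y)" using x by blast
    then have "y \<in> upper" "hyp_act h y \<in> upper" "x \<in> upper"
      using assms hyp_act_upper by blast+
    then show ?thesis
      using assms y by (simp add: PSL2.inv_mult_group hyp_act_mult hyp_act_inv)
  qed
  then show ?thesis
    by (simp add: ehorosphere_act_def hyp_act_image_mult[OF assms] cong: restrict_cong)
qed

lemma ehorosphere_act_one:
  assumes "\<phi> \<in> extensional H"
  shows "ehorosphere_act \<one>\<^bsub>PSL2\<^esub> (H, \<phi>) = (H, \<phi>)"
proof -
  have "hyp_act \<one>\<^bsub>PSL2\<^esub> = (\<lambda>x. x)" by (rule ext) (rule hyp_act_one)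
  then show ?thesis using assms by (simp add: ehorosphere_act_def extensional_restrict)
qed

section \<open>Classes transported from the standard horosphere\<close>

definition standard_ehorosphere :: ehorosphere where
  "standard_ehorosphere = (level 1, restrict fst (level 1))"

definition transported :: "(complex^2^2) set \<Rightarrow> ehorosphere set" where
  "transported g = translation_rel `` {ehorosphere_act g standard_ehorosphere}"

lemma transported_eq:
  assumes "g \<in> carrier PSL2"
  shows "transported g = {(hyp_act g ` level 1,
    restrict (\<lambda>x. fst (hyp_act (inv\<^bsub>PSL2\<^esub> g) x) + c) (hyp_act g ` level 1)) | c. True}"
proof -
  have "snd (hyp_act (inv\<^bsub>PSL2\<^esub> g) x) = 1" if "x \<in> hyp_act g ` level 1" for x
    using that hyp_act_inv(1)[OF assms] by auto
  then have "ehorosphere_act g standard_ehorosphere =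
     (hyp_act g ` level 1, restrict (\<lambda>x. fst (hyp_act (inv\<^bsub>PSL2\<^esub> g) x)) (hyp_act g ` level 1))"
    by (simp add: ehorosphere_act_def standard_ehorosphere_def cong: restrict_cong)
  then show ?thesis
    unfolding transported_def by (simp add: translation_class cong: restrict_cong)
qed

lemma ehorosphere_act_transported:
  assumes "g \<in> carrier PSL2" "h \<in> carrier PSL2"
  shows "ehorosphere_act g ` transported h = transported (g \<otimes>\<^bsub>PSL2\<^esub> h)"
proof -
  have sub: "level 1 \<subseteq> upper" by auto
  have "hyp_act h ` level 1 \<subseteq> upper" using hyp_act_upper[OF assms(2)] sub by blast
  then have "ehorosphere_act g ` transported h =
      translation_rel `` {ehorosphere_act g (ehorosphere_act h standard_ehorosphere)}"
    unfolding transported_def standard_ehorosphere_def ehorosphere_act_def[of h]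
    using ehorosphere_act_class[OF assms(1)] by simp
  also have "\<dots> = transported (g \<otimes>\<^bsub>PSL2\<^esub> h)"
    unfolding transported_def standard_ehorosphere_def ehorosphere_act_mult[OF assms sub] ..
  finally show ?thesis .
qed

lemma psl_of_fixing_infinity:
  assumes "g \<in> carrier PSL2" "boundary_act g Infinity = Infinity"
  obtains a b d where "a * d = 1" "g = psl_of (mat2 a b 0 d)"
proof -
  obtain A where A: "det A = 1" "g = psl_of A" using assms by (auto simp: carrier_PSL2)
  have c: "A$2$1 = 0" using assms(2) by (simp add: A boundary_act_psl_of split: if_splits)
  have "A = mat2 (A$1$1) (A$1$2) 0 (A$2$2)" by (simp add: matrix_2_eq_iff c)
  then show ?thesis using that[of "A$1$1" "A$2$2" "A$1$2"] A c by (simp add: det_2)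
qed

text \<open>The substantial condition is the one on orientation: elements fixing infinity act on the
  plane by complex affine maps, whose Jacobian is positive.\<close>

lemma standard_ehorosphere_mem: "standard_ehorosphere \<in> ehorospheres Infinity"
proof -
  have bij: "bij_betw (restrict fst (level 1)) (level 1) (UNIV :: complex set)"
    by (rule bij_betwI[where g = "\<lambda>z. (z, 1)"]) auto
  have inv: "inv_into (level 1) (restrict fst (level 1)) = (\<lambda>w :: complex. (w, 1))"
    by (rule ext, rule inv_into_f_eq) (use bij in \<open>auto simp: bij_betw_def\<close>)
  have der: "((\<lambda>w. (w, 1 :: real)) has_derivative (\<lambda>\<xi>. (\<xi>, 0))) (at w)" for w :: complex
    by (auto intro!: derivative_eq_intros)
  have "orientation_preserving (\<lambda>w. fst (hyp_act (inv\<^bsub>PSL2\<^esub> g) (w, 1)))"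
    if g: "g \<in> carrier PSL2" "boundary_act g Infinity = Infinity" for g
  proof -
    have "inv\<^bsub>PSL2\<^esub> g \<in> carrier PSL2" "boundary_act (inv\<^bsub>PSL2\<^esub> g) Infinity = Infinity"
      using g boundary_act_inv(1)[of g Infinity] by simp_all
    then obtain a b d where ad: "a * d = 1" "inv\<^bsub>PSL2\<^esub> g = psl_of (mat2 a b 0 d)"
      by (rule psl_of_fixing_infinity)
    have "(\<lambda>w. fst (hyp_act (inv\<^bsub>PSL2\<^esub> g) (w, 1))) = (\<lambda>w. a\<^sup>2 * w + a * b)"
      by (simp add: ad(2) hyp_act_psl_of sl_act_upper_triangular[OF ad(1)])
    moreover have "((\<lambda>w. a\<^sup>2 * w + a * b) has_derivative (\<lambda>\<xi>. a\<^sup>2 * \<xi>)) (at w)" for w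
      by (auto intro!: derivative_eq_intros)
    moreover have "Im (cnj (a\<^sup>2 * 1) * (a\<^sup>2 * \<i>)) > 0"
    proof -
      have *: "cnj (a\<^sup>2 * 1) * (a\<^sup>2 * \<i>) = of_real ((cmod (a\<^sup>2))\<^sup>2) * \<i>"
        unfolding complex_norm_square by (simp add: mult_ac)
      have "Im (of_real r * \<i>) = r" for r by simp
      moreover have "a \<noteq> 0" using ad by auto
      ultimately show ?thesis unfolding * by simp
    qed
    ultimately show ?thesis unfolding orientation_preserving_def by metis
  qed
  moreover have "\<exists>D. ((\<lambda>w. (w, 1 :: real)) has_derivative D) (at w) \<and>
      (\<forall>\<xi>. norm (D \<xi>) / 1 = norm \<xi>)" for w :: complex
    by (rule exI[of _ "\<lambda>\<xi>. (\<xi>, 0)"]) (simp add: der norm_Pair)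
  moreover have "horosphere Infinity (level 1)"
    by (auto simp: case_prod_unfold intro!: exI[of _ "1 :: real"])
  ultimately show ?thesis
    unfolding standard_ehorosphere_def ehorospheres_def
    using bij by (simp add: inv Let_def del: horosphere.simps)
qed

text \<open>The norms at \<open>1\<close>, \<open>\<i>\<close> and \<open>1 + \<i>\<close> make the
  images of \<open>1\<close> and \<open>\<i>\<close> orthogonal of length \<open>h\<close>;
  positivity of the determinant then selects \<open>\<i> * L 1\<close> among the two candidates for
  \<open>L \<i>\<close>.\<close>

lemma conformal_linear_complex:
  fixes L :: "complex \<Rightarrow> complex"
  assumes lin: "linear L" and norm: "\<And>\<xi>. cmod (L \<xi>) = h * cmod \<xi>"
    and pos: "Im (cnj (L 1) * L \<i>) > 0"
  shows "L \<xi> = L 1 * \<xi>"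
proof -
  obtain a b x y where L: "L 1 = Complex a b" "L \<i> = Complex x y" by (metis complex.exhaust)
  have sq: "(cmod (L \<xi>))\<^sup>2 = h\<^sup>2 * (cmod \<xi>)\<^sup>2" for \<xi> by (simp add: norm power_mult_distrib)
  have "L (1 + \<i>) = L 1 + L \<i>" using lin by (rule linear_add)
  then have "a\<^sup>2 + b\<^sup>2 = h\<^sup>2" "x\<^sup>2 + y\<^sup>2 = h\<^sup>2" "(a + x)\<^sup>2 + (b + y)\<^sup>2 = 2 * h\<^sup>2"
    using sq[of 1] sq[of \<i>] sq[of "1 + \<i>"] by (simp_all add: L cmod_power2)
  then have n: "a\<^sup>2 + b\<^sup>2 = h\<^sup>2" "x\<^sup>2 + y\<^sup>2 = h\<^sup>2" "a * x + b * y = 0"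
    by (auto simp: power2_eq_square algebra_simps)
  \<comment> \<open>Lagrange's identity; as the inner product vanishes, it gives the determinant up
    to sign.\<close>
  have "(a * y - b * x)\<^sup>2 + (a * x + b * y)\<^sup>2 = (a\<^sup>2 + b\<^sup>2) * (x\<^sup>2 + y\<^sup>2)" by algebra
  then have "(a * y - b * x)\<^sup>2 = (h\<^sup>2)\<^sup>2" using n by (simp add: power2_eq_square)
  moreover have "a * y - b * x > 0" using pos by (simp add: L)
  ultimately have "a * y - b * x = h\<^sup>2" using power2_eq_iff_nonneg[of "a * y - b * x" "h\<^sup>2"] by simp
  \<comment> \<open>The left side is the squared modulus of
    \<open>L \<i> - \<i> * L 1\<close>.\<close>
  moreover have "(x + b)\<^sup>2 + (y - a)\<^sup>2 = (x\<^sup>2 + y\<^sup>2) + (a\<^sup>2 + b\<^sup>2) - 2 * (a * y - b * x)" by algebra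
  ultimately have "(x + b)\<^sup>2 + (y - a)\<^sup>2 = 0" using n by simp
  then have "x + b = 0 \<and> y - a = 0" by (simp only: sum_power2_eq_zero_iff)
  then have "x = - b" "y = a" by (simp_all add: add_eq_0_iff2)
  then have i: "L \<i> = L 1 * \<i>" by (simp add: L complex_eq_iff)
  have "\<xi> = Re \<xi> *\<^sub>R 1 + Im \<xi> *\<^sub>R \<i>" by (simp add: complex_eq_iff)
  then have "L \<xi> = L (Re \<xi> *\<^sub>R 1 + Im \<xi> *\<^sub>R \<i>)" by (rule arg_cong)
  also have "\<dots> = Re \<xi> *\<^sub>R L 1 + Im \<xi> *\<^sub>R L \<i>"
    using lin by (simp only: linear_add linear_scale)
  also have "\<dots> = L 1 * \<xi>" unfolding i by (simp add: complex_eq_iff algebra_simps)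
  finally show ?thesis .
qed

text \<open>By Liouville's theorem, as the derivative is bounded.\<close>

lemma conformal_constant_scale_affine:
  assumes "\<And>w. \<exists>p. (f has_field_derivative p) (at w) \<and> cmod p = h"
  shows "\<exists>p q. cmod p = h \<and> (\<forall>w. f w = p * w + q)"
proof -
  have der: "(f has_field_derivative deriv f w) (at w)" and n: "cmod (deriv f w) = h" for w
    using assms[of w] DERIV_imp_deriv by auto
  have "f holomorphic_on UNIV"
    using der by (auto simp: holomorphic_on_open)
  then have "deriv f holomorphic_on UNIV" by (rule holomorphic_deriv) simp
  moreover have "bounded (range (deriv f))" using n by (auto simp: bounded_iff)
  ultimately have "deriv f constant_on UNIV" by (rule Liouville_theorem)
  then obtain p where p: "\<And>w. deriv f w = p" by (auto simp: constant_on_def)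
  have "\<exists>q. \<forall>w \<in> UNIV. f w - p * w = q"
  proof (rule has_field_derivative_zero_constant)
    show "((\<lambda>w. f w - p * w) has_field_derivative 0) (at w within UNIV)" for w
      using der[of w] by (auto simp: p intro!: derivative_eq_intros)
  qed simp
  then obtain q where "\<And>w. f w - p * w = q" by auto
  then have "f w = p * w + q" for w by (metis diff_add_cancel add.commute)
  then show ?thesis using n p by metis
qed

text \<open>The inverse isometry turns out to be \<open>p * w + q\<close> at the constant height
  \<open>h = |p|\<close>. A diagonal element with multiplier \<open>p\<close> produces the same
  horosphere and chart from the standard ones, up to the translation caused by
  \<open>q\<close>.\<close>

lemma ehorospheres_Infinity_classes:
  assumes E: "E \<in> ehorospheres Infinity"
  shows "\<exists>g \<in> carrier PSL2. boundary_act g Infinity = Infinity \<and>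
    translation_rel `` {E} = transported g"
proof -
  obtain H \<phi> where E_eq: "E = (H, \<phi>)" by (cases E)
  define \<psi> where "\<psi> = inv_into H \<phi>"
  have H: "horosphere Infinity H" and phi_ext: "\<phi> \<in> extensional H" and bij: "bij_betw \<phi> H UNIV"
    and der: "\<And>w. \<exists>D. (\<psi> has_derivative D) (at w) \<and> (\<forall>\<xi>. norm (D \<xi>) / snd (\<psi> w) = norm \<xi>)"
    and ori: "\<And>k. k \<in> carrier PSL2 \<Longrightarrow> boundary_act k Infinity = Infinity \<Longrightarrow>
      orientation_preserving (\<lambda>w. fst (hyp_act (inv\<^bsub>PSL2\<^esub> k) (\<psi> w)))"
    using E unfolding E_eq ehorospheres_def by (auto simp: Let_def \<psi>_def simp del: horosphere.simps)
  obtain h where h: "h > 0" and Hh: "H = level h" using H by (auto simp: case_prod_unfold)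
  have \<psi>: "\<psi> w \<in> H" "\<phi> (\<psi> w) = w" for w
    unfolding \<psi>_def using bij by (auto simp: bij_betw_def f_inv_into_f inv_into_into)
  have snd: "snd (\<psi> w) = h" for w using \<psi>(1)[of w] by (simp add: Hh)
  have \<psi>\<phi>: "\<psi> (\<phi> x) = x" if "x \<in> H" for x
    unfolding \<psi>_def using bij that by (auto simp: bij_betw_def)
  \<comment> \<open>The orientation condition is used for the identity element only.\<close>
  have ori1: "orientation_preserving (\<lambda>w. fst (\<psi> w))"
    using ori[OF PSL2.one_closed boundary_act_one] by (simp add: hyp_act_one)
  have "\<exists>p. ((\<lambda>w. fst (\<psi> w)) has_field_derivative p) (at w) \<and> cmod p = h" for w
  proof -
    obtain D where D: "(\<psi> has_derivative D) (at w)" "\<And>\<xi>. norm (D \<xi>) / snd (\<psi> w) = norm \<xi>"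
      using der by blast
    obtain L where L: "((\<lambda>w. fst (\<psi> w)) has_derivative L) (at w)" "Im (cnj (L 1) * L \<i>) > 0"
      using ori1 unfolding orientation_preserving_def by blast
    have "((\<lambda>w. snd (\<psi> w)) has_derivative (\<lambda>\<xi>. snd (D \<xi>))) (at w)"
      using D(1) by (rule has_derivative_snd)
    then have "((\<lambda>w. h) has_derivative (\<lambda>\<xi>. snd (D \<xi>))) (at w)" by (simp add: snd)
    \<comment> \<open>At constant height the vertical part of the derivative vanishes, so the metric
      condition concerns the horizontal part \<open>L\<close> alone.\<close>
    then have sndD: "(\<lambda>\<xi>. snd (D \<xi>)) = (\<lambda>\<xi>. 0)"
      using has_derivative_const by (rule has_derivative_unique)
    have "((\<lambda>w. fst (\<psi> w)) has_derivative (\<lambda>\<xi>. fst (D \<xi>))) (at w)"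
      using D(1) by (rule has_derivative_fst)
    then have fstD: "(\<lambda>\<xi>. fst (D \<xi>)) = L" using L(1) by (rule has_derivative_unique)
    have "cmod (L \<xi>) = h * cmod \<xi>" for \<xi>
    proof -
      have "norm (D \<xi>) = cmod (L \<xi>)"
        using fun_cong[OF sndD, of \<xi>] fun_cong[OF fstD, of \<xi>] by (simp add: norm_prod_def)
      then show ?thesis using D(2)[of \<xi>] h by (simp add: snd field_simps)
    qed
    moreover from this have scale: "L \<xi> = L 1 * \<xi>" for \<xi>
      using L by (intro conformal_linear_complex) (auto intro: has_derivative_linear)
    have "L = (*) (L 1)" by (rule ext) (rule scale)
    ultimately show ?thesis
      using L(1) by (intro exI[of _ "L 1"]) (simp add: has_field_derivative_def)
  qed
  then obtain p q where p: "cmod p = h" and \<psi>_affine: "\<And>w. fst (\<psi> w) = p * w + q"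
    using conformal_constant_scale_affine by metis
  have p0: "p \<noteq> 0" using p h by auto
  have \<phi>_affine: "\<phi> x = fst x / p - q / p" if "x \<in> H" for x
    using \<psi>_affine[of "\<phi> x"] \<psi>\<phi>[OF that] p0 by (simp add: field_simps)
  \<comment> \<open>A square root, since the diagonal matrix with entries \<open>a\<close> and
    \<open>1 / a\<close> multiplies by \<open>a^2\<close>.\<close>
  define a where "a = csqrt p"
  have a2: "a\<^sup>2 = p" by (simp add: a_def)
  have a0: "a \<noteq> 0" using a2 p0 by auto
  define g where "g = psl_of (mat2 a 0 0 (1 / a))"
  have g: "g \<in> carrier PSL2" unfolding g_def using a0 by simp
  have hyp_g: "hyp_act g x = (p * fst x, h * snd x)" for x
    using a0 sl_act_upper_triangular[of a "1 / a" 0 x]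
    by (simp add: g_def hyp_act_psl_of a2 flip: norm_power p)
  have "inv\<^bsub>PSL2\<^esub> g = psl_of (mat2 (1 / a) 0 0 a)"
    unfolding g_def using a0 by (simp add: inv_psl_of adj2_def)
  then have inv_g: "fst (hyp_act (inv\<^bsub>PSL2\<^esub> g) x) = fst x / p" for x
    using a0 sl_act_upper_triangular[of "1 / a" a 0 x]
    by (simp add: hyp_act_psl_of power_divide a2)
  have "hyp_act g ` level 1 = H"
  proof (intro equalityI subsetI)
    fix x assume "x \<in> H"
    then have "x = hyp_act g (fst x / p, 1)" using p0 by (simp add: hyp_g Hh prod_eq_iff)
    then show "x \<in> hyp_act g ` level 1" by (rule image_eqI) simp
  qed (auto simp: hyp_g Hh)
  then have tr: "transported g = {(H, restrict (\<lambda>x. fst x / p + c) H) | c. True}"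
    by (simp add: transported_eq[OF g] inv_g)
  have "\<phi> = restrict (\<lambda>x. fst x / p + (- q / p)) H"
    by (rule extensionalityI[OF phi_ext restrict_extensional]) (simp add: \<phi>_affine)
  then have "E \<in> transported g" unfolding tr E_eq by blast
  then have "translation_rel `` {E} = transported g"
    unfolding transported_def using translation_class_eqI by blast
  moreover have "boundary_act g Infinity = Infinity" by (simp add: g_def boundary_act_psl_of)
  ultimately show ?thesis using g by blast
qed

text \<open>Some \<open>k\<close> carries infinity to \<open>v\<close>; its inverse reduces the
  claim to infinity, and acting by \<open>k\<close> brings the class back.\<close>

lemma ehorosphere_classes_iff:
  "E \<in> ehorospheres v // translation_rel \<longleftrightarrow>
    (\<exists>g \<in> carrier PSL2. boundary_act g Infinity = v \<and> E = transported g)"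
proof
  assume "\<exists>g \<in> carrier PSL2. boundary_act g Infinity = v \<and> E = transported g"
  then show "E \<in> ehorospheres v // translation_rel"
    using ehorosphere_act_mem[OF _ standard_ehorosphere_mem]
    unfolding transported_def quotient_def by auto
next
  assume "E \<in> ehorospheres v // translation_rel"
  then obtain X where X: "X \<in> ehorospheres v" "E = translation_rel `` {X}"
    unfolding quotient_def by blast
  obtain H \<phi> where HX: "X = (H, \<phi>)" by (cases X)
  have "horosphere v H" and phi_ext: "\<phi> \<in> extensional H" using X(1) by (auto simp: HX ehorospheres_def)
  then have up: "H \<subseteq> upper" by (blast dest: horosphere_subset_upper)
  obtain k where k: "k \<in> carrier PSL2" "boundary_act k Infinity = v"
    using boundary_act_transitive by blast
  let ?Y = "ehorosphere_act (inv\<^bsub>PSL2\<^esub> k) X"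
  have "boundary_act (inv\<^bsub>PSL2\<^esub> k) v = Infinity"
    using k by (auto simp: boundary_act_inv)
  then have Y: "?Y \<in> ehorospheres Infinity"
    using ehorosphere_act_mem[of "inv\<^bsub>PSL2\<^esub> k" X v] k X by simp
  then obtain m where m: "m \<in> carrier PSL2" "boundary_act m Infinity = Infinity"
    "translation_rel `` {?Y} = transported m"
    using ehorospheres_Infinity_classes by blast
  obtain H' \<phi>' where HY: "?Y = (H', \<phi>')" by (cases ?Y)
  have up': "H' \<subseteq> upper"
    using Y horosphere_subset_upper[of Infinity H'] by (auto simp: HY ehorospheres_def)
  \<comment> \<open>Exact equality, not just equality on \<open>H\<close>, because
    \<open>\<phi>\<close> is extensional.\<close>
  have "ehorosphere_act k ?Y = X"
    using k phi_ext up by (simp add: HX ehorosphere_act_one flip: ehorosphere_act_mult)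
  then have "E = ehorosphere_act k ` transported m"
    using ehorosphere_act_class[OF k(1) up', of \<phi>'] by (simp add: X HY flip: m(3))
  also have "\<dots> = transported (k \<otimes>\<^bsub>PSL2\<^esub> m)"
    using k m by (simp add: ehorosphere_act_transported)
  finally show "\<exists>g \<in> carrier PSL2. boundary_act g Infinity = v \<and> E = transported g"
    using k m by (intro bexI[of _ "k \<otimes>\<^bsub>PSL2\<^esub> m"]) (simp_all add: boundary_act_mult)
qed

text \<open>Acting by the inverse of \<open>g\<close> reduces to comparing the identity with
  \<open>k\<close>, which is upper triangular. The charts then agree up to translation exactly when
  the multiplier \<open>d^2\<close> is 1, that is, when \<open>k\<close> is unipotent up to
  sign.\<close>

lemma transported_eq_iff:
  assumes g: "g \<in> carrier PSL2" and h: "h \<in> carrier PSL2"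
    and v: "boundary_act g Infinity = boundary_act h Infinity"
  shows "transported g = transported h \<longleftrightarrow> inv\<^bsub>PSL2\<^esub> g \<otimes>\<^bsub>PSL2\<^esub> h \<in> unipotent"
proof -
  define k where "k = inv\<^bsub>PSL2\<^esub> g \<otimes>\<^bsub>PSL2\<^esub> h"
  have k: "k \<in> carrier PSL2" and gk: "g \<otimes>\<^bsub>PSL2\<^esub> k = h"
    using g h by (simp_all add: k_def flip: PSL2.m_assoc)
  have "boundary_act k Infinity = Infinity"
    using g h v by (simp add: k_def boundary_act_mult boundary_act_inv flip: v)
  then obtain a b d where ad: "a * d = 1" and ka: "k = psl_of (mat2 a b 0 d)"
    by (rule psl_of_fixing_infinity[OF k])
  have a0: "a \<noteq> 0" using ad by auto
  have "inv\<^bsub>PSL2\<^esub> k = psl_of (mat2 d (- b) 0 a)"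
    unfolding ka using ad by (simp add: inv_psl_of adj2_def)
  then have inv_k: "fst (hyp_act (inv\<^bsub>PSL2\<^esub> k) x) = d\<^sup>2 * fst x - d * b" for x
    using ad by (simp add: hyp_act_psl_of sl_act_upper_triangular mult.commute[of d a])
  have id: "hyp_act \<one>\<^bsub>PSL2\<^esub> = (\<lambda>x. x)" by (rule ext) (rule hyp_act_one)
  have one: "transported \<one>\<^bsub>PSL2\<^esub> = {(level 1, restrict (\<lambda>x. fst x + c) (level 1)) | c. True}"
    by (simp add: transported_eq id)
  have tr: "transported k = {(hyp_act k ` level 1,
      restrict (\<lambda>x. d\<^sup>2 * fst x - d * b + c) (hyp_act k ` level 1)) | c. True}"
    by (simp add: transported_eq[OF k] inv_k)
  have "transported g = transported h \<longleftrightarrow> transported \<one>\<^bsub>PSL2\<^esub> = transported k"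
  proof
    assume "transported g = transported h"
    then have "ehorosphere_act (inv\<^bsub>PSL2\<^esub> g) ` transported g = ehorosphere_act (inv\<^bsub>PSL2\<^esub> g) ` transported h"
      by simp
    then show "transported \<one>\<^bsub>PSL2\<^esub> = transported k"
      using g h by (simp add: ehorosphere_act_transported k_def)
  next
    assume "transported \<one>\<^bsub>PSL2\<^esub> = transported k"
    then have "ehorosphere_act g ` transported \<one>\<^bsub>PSL2\<^esub> = ehorosphere_act g ` transported k"
      by simp
    then show "transported g = transported h"
      using g h k by (simp add: ehorosphere_act_transported gk)
  qed
  also have "\<dots> \<longleftrightarrow> k \<in> unipotent"
  proof
    assume eq: "transported \<one>\<^bsub>PSL2\<^esub> = transported k"
    have "(level 1, restrict (\<lambda>x. fst x + 0) (level 1)) \<in> transported k"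
      unfolding eq[symmetric] one by blast
    then obtain c where "restrict (\<lambda>x. fst x + 0) (level 1) =
        restrict (\<lambda>x. d\<^sup>2 * fst x - d * b + c) (level 1)"
      unfolding tr by auto
    then have "z = d\<^sup>2 * z - d * b + c" for z
      by (drule_tac fun_cong[of _ _ "(z, 1)"]) simp
    \<comment> \<open>Subtracting the two values removes the unknown translation
      \<open>c\<close>.\<close>
    from this[of 0] this[of 1] have "d\<^sup>2 = 1" by simp
    then have "d = 1 \<or> d = - 1" by (simp add: power2_eq_1_iff)
    then show "k \<in> unipotent"
    proof
      assume "d = 1"
      then show ?thesis using ad by (auto simp: ka unipotent_def)
    next
      assume "d = - 1"
      then have "a = - 1" using ad by (simp add: minus_equation_iff)
      \<comment> \<open>The opposite matrix represents the same element and has 1 on the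
        diagonal.\<close>
      then have "k = psl_of (mat2 1 (- b) 0 1)"
        unfolding ka psl_of_eq_iff using \<open>d = - 1\<close> by (simp add: matrix_2_eq_iff)
      then show ?thesis by (auto simp: unipotent_def)
    qed
  next
    assume "k \<in> unipotent"
    then obtain x where kx: "k = psl_of (mat2 1 x 0 1)" by (auto simp: unipotent_def)
    have hk: "hyp_act k y = (fst y + x, snd y)" for y
      using sl_act_upper_triangular[of 1 1 x y] by (simp add: kx hyp_act_psl_of)
    have inv_k: "fst (hyp_act (inv\<^bsub>PSL2\<^esub> k) y) = fst y - x" for y
      using sl_act_upper_triangular[of 1 1 "- x" y]
      by (simp add: kx inv_psl_of adj2_def hyp_act_psl_of)
    have im: "hyp_act k ` level 1 = level 1"
    proof (intro equalityI subsetI)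
      fix y :: "complex \<times> real" assume "y \<in> level 1"
      then have "y = hyp_act k (fst y - x, 1)" by (simp add: hk prod_eq_iff)
      then show "y \<in> hyp_act k ` level 1" by (rule image_eqI) simp
    qed (auto simp: hk)
    have "transported k = {(level 1, restrict (\<lambda>y. fst y - x + c) (level 1)) | c. True}"
      by (simp add: transported_eq[OF k] inv_k im)
    also have "\<dots> = {(level 1, restrict (\<lambda>y. fst y + c) (level 1)) | c. True}"
    proof (intro equalityI subsetI)
      fix X assume "X \<in> {(level 1, restrict (\<lambda>y. fst y - x + c) (level 1)) | c. True}"
      then obtain c where "X = (level 1, restrict (\<lambda>y. fst y - x + c) (level 1))" by blast
      then have "X = (level 1, restrict (\<lambda>y. fst y + (c - x)) (level 1))" by (simp add: algebra_simps)
      then show "X \<in> {(level 1, restrict (\<lambda>y. fst y + c) (level 1)) | c. True}" by blast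
    next
      fix X :: ehorosphere assume "X \<in> {(level 1, restrict (\<lambda>y. fst y + c) (level 1)) | c. True}"
      then obtain c where "X = (level 1, restrict (\<lambda>y. fst y + c) (level 1))" by blast
      then have "X = (level 1, restrict (\<lambda>y. fst y - x + (c + x)) (level 1))" by simp
      then show "X \<in> {(level 1, restrict (\<lambda>y. fst y - x + c) (level 1)) | c. True}" by blast
    qed
    finally show "transported \<one>\<^bsub>PSL2\<^esub> = transported k" unfolding one ..
  qed
  finally show ?thesis by (simp add: k_def)
qed


section \<open>Intersection triangles\<close>

abbreviation unip :: "complex \<Rightarrow> (complex^2^2) set" where
  "unip x \<equiv> psl_of (mat2 1 x 0 1)"

lemma unip_carrier: "unip x \<in> carrier PSL2"
  by simp

lemma unip_mult: "unip x \<otimes>\<^bsub>PSL2\<^esub> unip y = unip (x + y)"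
  by (simp add: psl_of_mult psl_of_eq_iff matrix_2_eq_iff matrix_mult_2_nth add.commute)

lemma inv_unip: "inv\<^bsub>PSL2\<^esub> unip x = unip (- x)"
  by (simp add: inv_psl_of adj2_def)

lemma unip_eq_iff: "unip x = unip y \<longleftrightarrow> x = y"
  by (simp add: psl_of_eq_iff matrix_2_eq_iff)

lemma boundary_act_unip:
  "boundary_act (unip x) Infinity = Infinity" "boundary_act (unip x) (Fin z) = Fin (z + x)"
  by (simp_all add: boundary_act_psl_of)

lemma hyp_act_unip: "hyp_act (unip x) y = (fst y + x, snd y)"
  using sl_act_upper_triangular[of 1 1 x y] by (simp add: hyp_act_psl_of)

text \<open>Right multiplication by a unipotent element is the freedom left by a decorated vertex:
  base point and horosphere class stay, only the other end of the marked geodesic moves.\<close>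

lemma mult_unip:
  assumes "g \<in> carrier PSL2"
  shows "boundary_act (g \<otimes>\<^bsub>PSL2\<^esub> unip x) Infinity = boundary_act g Infinity"
    "boundary_act (g \<otimes>\<^bsub>PSL2\<^esub> unip x) (Fin 0) = boundary_act g (Fin x)"
    "hyp_act (g \<otimes>\<^bsub>PSL2\<^esub> unip x) (0, 1) = hyp_act g (x, 1)"
    "hyp_act (g \<otimes>\<^bsub>PSL2\<^esub> unip x) ` level 1 = hyp_act g ` level 1"
    "transported (g \<otimes>\<^bsub>PSL2\<^esub> unip x) = transported g"
proof -
  show inf: "boundary_act (g \<otimes>\<^bsub>PSL2\<^esub> unip x) Infinity = boundary_act g Infinity"
    "boundary_act (g \<otimes>\<^bsub>PSL2\<^esub> unip x) (Fin 0) = boundary_act g (Fin x)"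
    "hyp_act (g \<otimes>\<^bsub>PSL2\<^esub> unip x) (0, 1) = hyp_act g (x, 1)"
    using assms unip_carrier[of x]
    by (simp_all add: boundary_act_mult boundary_act_unip hyp_act_mult hyp_act_unip)
  have "inv\<^bsub>PSL2\<^esub> g \<otimes>\<^bsub>PSL2\<^esub> (g \<otimes>\<^bsub>PSL2\<^esub> unip x) = unip x"
    using assms unip_carrier[of x] by (simp flip: PSL2.m_assoc)
  then show tr: "transported (g \<otimes>\<^bsub>PSL2\<^esub> unip x) = transported g"
    using assms unip_carrier[of x] inf(1)
    by (subst eq_commute) (auto simp: transported_eq_iff unipotent_def)
  \<comment> \<open>The horosphere is the first component of every member of the class, so it is
    unchanged when the class is.\<close>
  have "(H, \<phi>) \<in> transported h \<Longrightarrow> H = hyp_act h ` level 1" if "h \<in> carrier PSL2" for h H \<phi>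
    unfolding transported_eq[OF that] by blast
  moreover have "\<exists>\<phi>. (hyp_act g ` level 1, \<phi>) \<in> transported g"
    unfolding transported_eq[OF assms] by blast
  moreover have "g \<otimes>\<^bsub>PSL2\<^esub> unip x \<in> carrier PSL2" using assms unip_carrier by blast
  ultimately show "hyp_act (g \<otimes>\<^bsub>PSL2\<^esub> unip x) ` level 1 = hyp_act g ` level 1"
    using tr by metis
qed

text \<open>The plane of height 1 meets the vertical line over 0 in one point, and injectivity of
  the action transfers this to the images.\<close>

lemma intersection_corner_hyp_act:
  assumes g: "g \<in> carrier PSL2"
  shows "intersection_corner (hyp_act g ` level 1) (boundary_act g Infinity) (boundary_act g (Fin 0)) =
    hyp_act g (0, 1)"
proof -
  have "level 1 \<subseteq> upper" "ideal_geodesic Infinity (Fin 0) \<subseteq> upper" by auto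
  then have "hyp_act g ` level 1 \<inter> hyp_act g ` ideal_geodesic Infinity (Fin 0) =
      hyp_act g ` (level 1 \<inter> ideal_geodesic Infinity (Fin 0))"
    using inj_on_image_Int[OF inj_on_hyp_act[OF g]] by blast
  also have "level 1 \<inter> ideal_geodesic Infinity (Fin 0) = {(0, 1)}" by auto
  finally show ?thesis
    unfolding intersection_corner_def hyp_act_geodesic[OF g] by simp
qed

text \<open>In the chart given by \<open>g\<close>, the corner towards \<open>v m\<close> lies at
  \<open>x m\<close>: after right multiplication by \<open>unip (x m)\<close> it becomes the corner
  of the marked geodesic.\<close>

lemma intersection_triangle_eq:
  assumes g: "g \<in> carrier PSL2" and vi: "boundary_act g Infinity = v i"
    and x: "\<And>m. m \<noteq> i \<Longrightarrow> boundary_act g (Fin (x m)) = v m"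
    and E: "E i = transported g"
  shows "intersection_triangle (v, E) i =
    {T \<in> extensional {j. j \<noteq> i}. \<exists>c. \<forall>m. m \<noteq> i \<longrightarrow> T m = x m + c}"
proof -
  have corner: "intersection_corner (hyp_act g ` level 1) (v i) (v m) = hyp_act g (x m, 1)"
    if "m \<noteq> i" for m
    using intersection_corner_hyp_act[of "g \<otimes>\<^bsub>PSL2\<^esub> unip (x m)"] g unip_carrier[of "x m"]
    by (simp add: mult_unip vi x that)
  have *: "restrict (\<lambda>j. restrict (\<lambda>y. fst (hyp_act (inv\<^bsub>PSL2\<^esub> g) y) + c) (hyp_act g ` level 1)
        (intersection_corner (hyp_act g ` level 1) (v i) (v j))) {j. j \<noteq> i} =
      restrict (\<lambda>j. x j + c) {j. j \<noteq> i}" for c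
    using hyp_act_inv(1)[OF g] by (intro restrict_ext) (simp add: corner)
  have "intersection_triangle (v, E) i =
      {restrict (\<lambda>j. restrict (\<lambda>y. fst (hyp_act (inv\<^bsub>PSL2\<^esub> g) y) + c) (hyp_act g ` level 1)
        (intersection_corner (hyp_act g ` level 1) (v i) (v j))) {j. j \<noteq> i} | c. True}"
    unfolding intersection_triangle_def prod.case E transported_eq[OF g]
    by (simp only: simp_thms full_SetCompr_eq image_image prod.case)
  also have "\<dots> = {restrict (\<lambda>j. x j + c) {j. j \<noteq> i} | c. True}" unfolding * ..
  also have "\<dots> = {T \<in> extensional {j. j \<noteq> i}. \<exists>c. \<forall>m. m \<noteq> i \<longrightarrow> T m = x m + c}"
  proof (intro equalityI subsetI)
    fix T assume "T \<in> {T \<in> extensional {j. j \<noteq> i}. \<exists>c. \<forall>m. m \<noteq> i \<longrightarrow> T m = x m + c}"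
    then obtain c where T: "T \<in> extensional {j. j \<noteq> i}" "\<And>m. m \<noteq> i \<Longrightarrow> T m = x m + c" by blast
    have "T = restrict (\<lambda>j. x j + c) {j. j \<noteq> i}"
      by (rule extensionalityI[OF T(1) restrict_extensional]) (simp add: T(2))
    then show "T \<in> {restrict (\<lambda>j. x j + c) {j. j \<noteq> i} | c. True}" by blast
  qed auto
  finally show ?thesis .
qed

text \<open>By injectivity of \<open>v\<close>, no other vertex is pulled back to infinity.\<close>

lemma boundary_coordinates:
  assumes "g \<in> carrier PSL2" "boundary_act g Infinity = v i" "inj v"
  obtains x where "\<And>m. m \<noteq> i \<Longrightarrow> boundary_act g (Fin (x m)) = v m"
proof -
  have "\<exists>z. boundary_act g (Fin z) = v m" if "m \<noteq> i" for m
  proof (cases "boundary_act (inv\<^bsub>PSL2\<^esub> g) (v m)")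
    case (Fin z)
    then show ?thesis using boundary_act_inv(2)[OF assms(1), of "v m"] by auto
  next
    case Infinity
    then have "v m = v i" using boundary_act_inv(2)[OF assms(1), of "v m"] assms(2) by simp
    then show ?thesis using assms(3) that by (simp add: inj_eq)
  qed
  then show ?thesis using that by metis
qed

section \<open>Labelings and decorated simplices\<close>

text \<open>An intermediate relation that determines each \<open>l (i, j)\<close> directly and hence
  is easy to invert; on labelings and decorated simplices it agrees with \<open>corresponds\<close>.
  Extensionality fixes the values off \<open>truncated_vertices\<close>.\<close>

definition adapted :: "labeling \<Rightarrow> decorated_simplex \<Rightarrow> bool" where
  "adapted l D \<longleftrightarrow> l \<in> extensional truncated_vertices \<and>
     (\<forall>i j. i \<noteq> j \<longrightarrow> l (i, j) \<in> carrier PSL2 \<and> boundary_act (l (i, j)) Infinity = fst D i \<and>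
        boundary_act (l (i, j)) (Fin 0) = fst D j \<and> snd D i = transported (l (i, j)))"

lemma adaptedD:
  assumes "adapted l D" "i \<noteq> j"
  shows "l (i, j) \<in> carrier PSL2" "boundary_act (l (i, j)) Infinity = fst D i"
    "boundary_act (l (i, j)) (Fin 0) = fst D j" "transported (l (i, j)) = snd D i"
  using assms by (auto simp: adapted_def)

lemma exists_other_index: "\<exists>j. j \<noteq> (i :: 4)"
  by (rule exI[of _ "i + 1"]) simp

lemma exists_two_other_indices: "\<exists>j k. j \<noteq> (i :: 4) \<and> k \<noteq> i \<and> j \<noteq> k"
proof -
  have "card (UNIV - {i}) = 3" by simp
  then obtain j k l where eq: "UNIV - {i} = {j, k, l}" and jk: "j \<noteq> k"
    unfolding card_3_iff by blast
  have "j \<in> UNIV - {i}" "k \<in> UNIV - {i}" unfolding eq by simp_all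
  then show ?thesis using jk by blast
qed

lemma mem_lcoset_unipotent:
  assumes "g \<in> carrier PSL2" "h \<in> carrier PSL2"
  shows "h \<in> g <#\<^bsub>PSL2\<^esub> unipotent \<longleftrightarrow> inv\<^bsub>PSL2\<^esub> g \<otimes>\<^bsub>PSL2\<^esub> h \<in> unipotent"
proof
  assume "h \<in> g <#\<^bsub>PSL2\<^esub> unipotent"
  then obtain u where u: "u \<in> unipotent" "h = g \<otimes>\<^bsub>PSL2\<^esub> u" by (auto simp: l_coset_def)
  then have "u \<in> carrier PSL2" using unipotent_subset by blast
  then show "inv\<^bsub>PSL2\<^esub> g \<otimes>\<^bsub>PSL2\<^esub> h \<in> unipotent"
    using assms u by (simp flip: PSL2.m_assoc)
next
  assume "inv\<^bsub>PSL2\<^esub> g \<otimes>\<^bsub>PSL2\<^esub> h \<in> unipotent"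
  moreover have "h = g \<otimes>\<^bsub>PSL2\<^esub> (inv\<^bsub>PSL2\<^esub> g \<otimes>\<^bsub>PSL2\<^esub> h)"
    using assms by (simp flip: PSL2.m_assoc)
  ultimately show "h \<in> g <#\<^bsub>PSL2\<^esub> unipotent" by (auto simp: l_coset_def)
qed

lemma unipotent_lcoset_eq:
  assumes "g \<in> carrier PSL2" "inv\<^bsub>PSL2\<^esub> g \<otimes>\<^bsub>PSL2\<^esub> h \<in> unipotent" "h \<in> carrier PSL2"
  shows "g <#\<^bsub>PSL2\<^esub> unipotent = h <#\<^bsub>PSL2\<^esub> unipotent"
proof -
  obtain x where "inv\<^bsub>PSL2\<^esub> g \<otimes>\<^bsub>PSL2\<^esub> h = unip x" using assms(2) by (auto simp: unipotent_def)
  moreover have "h = g \<otimes>\<^bsub>PSL2\<^esub> (inv\<^bsub>PSL2\<^esub> g \<otimes>\<^bsub>PSL2\<^esub> h)"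
    using assms by (simp flip: PSL2.m_assoc)
  ultimately have h: "h = g \<otimes>\<^bsub>PSL2\<^esub> unip x" by simp
  have "h \<otimes>\<^bsub>PSL2\<^esub> unip y = g \<otimes>\<^bsub>PSL2\<^esub> unip (x + y)" for y
    using assms(1) unip_carrier by (simp add: h PSL2.m_assoc unip_mult)
  moreover have "g \<otimes>\<^bsub>PSL2\<^esub> unip y = h \<otimes>\<^bsub>PSL2\<^esub> unip (y - x)" for y
    using assms(1) unip_carrier by (simp add: h PSL2.m_assoc unip_mult)
  ultimately show ?thesis unfolding l_coset_def unipotent_def by blast
qed

text \<open>Exchanging infinity and 0 makes both diagonal entries vanish; the determinant then fixes
  one remaining entry by the other.\<close>

lemma counter_diagonal_iff:
  assumes "g \<in> carrier PSL2"
  shows "g \<in> counter_diagonal \<longleftrightarrow>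
    boundary_act g Infinity = Fin 0 \<and> boundary_act g (Fin 0) = Infinity"
proof
  assume "g \<in> counter_diagonal"
  then show "boundary_act g Infinity = Fin 0 \<and> boundary_act g (Fin 0) = Infinity"
    by (auto simp: counter_diagonal_def boundary_act_psl_of)
next
  assume *: "boundary_act g Infinity = Fin 0 \<and> boundary_act g (Fin 0) = Infinity"
  obtain A where A: "det A = 1" "g = psl_of A" using assms by (auto simp: carrier_PSL2)
  have 0: "A$1$1 = 0" "A$2$2 = 0"
    using * by (auto simp: A boundary_act_psl_of split: if_splits)
  then have bc: "- (A$1$2 * A$2$1) = 1" using A(1) by (simp add: det_2)
  then have c: "A$2$1 \<noteq> 0" by auto
  have "A$1$2 = - inverse (A$2$1)" using bc c by (simp add: field_simps minus_equation_iff)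
  then have "A = mat2 0 (- inverse (A$2$1)) (A$2$1) 0" by (simp add: matrix_2_eq_iff 0)
  then have "g = psl_of (mat2 0 (- inverse (A$2$1)) (A$2$1) 0)" using A(2) by simp
  then show "g \<in> counter_diagonal" unfolding counter_diagonal_def using c by blast
qed

section \<open>From labelings to decorated simplices and back\<close>

lemma labeling_adapted:
  assumes l: "l \<in> labelings"
  shows "\<exists>D \<in> decorated_simplices. adapted l D"
proof -
  \<comment> \<open>The second index \<open>i + 1\<close> is an arbitrary reference; the coset
    condition makes the result independent of it.\<close>
  define v where "v = (\<lambda>i. boundary_act (l (i, i + 1)) Infinity)"
  define E where "E = (\<lambda>i. transported (l (i, i + 1)))"
  have c: "l (i, j) \<in> carrier PSL2" if "i \<noteq> j" for i j
    using l that by (auto simp: labelings_def truncated_vertices_def)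
  have u: "inv\<^bsub>PSL2\<^esub> l (i, j) \<otimes>\<^bsub>PSL2\<^esub> l (i, k) \<in> unipotent" if "i \<noteq> j" "i \<noteq> k" "j \<noteq> k" for i j k
  proof -
    have "l (i, j) <#\<^bsub>PSL2\<^esub> unipotent = l (i, k) <#\<^bsub>PSL2\<^esub> unipotent"
      using l that unfolding labelings_def by blast
    moreover have "\<one>\<^bsub>PSL2\<^esub> \<in> unipotent"
      unfolding one_PSL2 unipotent_def by (auto simp: psl_of_eq_iff matrix_2_eq_iff intro!: exI[of _ 0])
    then have "l (i, k) \<in> l (i, k) <#\<^bsub>PSL2\<^esub> unipotent"
      using c that by (simp add: mem_lcoset_unipotent)
    ultimately show ?thesis using c that by (simp flip: mem_lcoset_unipotent)
  qed
  have inf: "boundary_act (l (i, j)) Infinity = v i \<and> transported (l (i, j)) = E i" if ij: "i \<noteq> j" for i j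
  proof (cases "j = i + 1")
    case False
    let ?g = "l (i, i + 1)"
    have g: "?g \<in> carrier PSL2" using c by simp
    obtain x where x: "inv\<^bsub>PSL2\<^esub> ?g \<otimes>\<^bsub>PSL2\<^esub> l (i, j) = unip x"
      using u[of i "i + 1" j] ij False by (auto simp: unipotent_def)
    have "l (i, j) = ?g \<otimes>\<^bsub>PSL2\<^esub> (inv\<^bsub>PSL2\<^esub> ?g \<otimes>\<^bsub>PSL2\<^esub> l (i, j))"
      using g c[OF ij] by (simp flip: PSL2.m_assoc)
    then have "l (i, j) = ?g \<otimes>\<^bsub>PSL2\<^esub> unip x" by (simp only: x)
    then show ?thesis using g by (simp add: mult_unip v_def E_def)
  qed (simp add: v_def E_def)
  have zero: "boundary_act (l (i, j)) (Fin 0) = v j" if "i \<noteq> j" for i j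
  proof -
    let ?k = "inv\<^bsub>PSL2\<^esub> l (i, j) \<otimes>\<^bsub>PSL2\<^esub> l (j, i)"
    have "?k \<in> counter_diagonal" using l that unfolding labelings_def by blast
    then have "boundary_act ?k Infinity = Fin 0"
      using c that by (simp add: counter_diagonal_iff)
    then have "boundary_act (l (i, j)) (Fin 0) =
        boundary_act (l (i, j)) (boundary_act (inv\<^bsub>PSL2\<^esub> l (i, j)) (boundary_act (l (j, i)) Infinity))"
      using c that by (simp add: boundary_act_mult)
    also have "\<dots> = v j" using c that inf[of j i] by (simp add: boundary_act_inv)
    finally show ?thesis .
  qed
  have "inj v"
  proof (rule injI, rule ccontr)
    fix i j assume eq: "v i = v j" and ij: "i \<noteq> j"
    \<comment> \<open>Coinciding vertices would make one group element identify infinity and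
      0.\<close>
    then have "boundary_act (l (i, j)) Infinity = boundary_act (l (i, j)) (Fin 0)"
      using zero inf by simp
    then show False using c[OF ij] by (simp add: boundary_act_eq_iff)
  qed
  moreover have "E i \<in> ehorospheres (v i) // translation_rel" for i
    unfolding ehorosphere_classes_iff using c[of i "i + 1"] by (auto simp: v_def E_def)
  ultimately have "(v, E) \<in> decorated_simplices" by (simp add: decorated_simplices_def)
  moreover have "l \<in> extensional truncated_vertices"
    using l by (auto simp: labelings_def PiE_def)
  then have "adapted l (v, E)"
    unfolding adapted_def using c inf zero by simp
  ultimately show ?thesis by blast
qed

lemma adapted_right_unique:
  assumes "adapted l D" "adapted l D'"
  shows "D = D'"
proof -
  have "i \<noteq> i + 1" for i :: 4 by simp
  then have "fst D i = fst D' i" "snd D i = snd D' i" for i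
    using adaptedD[OF assms(1), of i "i + 1"] adaptedD[OF assms(2), of i "i + 1"] by simp_all
  then show ?thesis by (simp add: prod_eq_iff fun_eq_iff)
qed

text \<open>Equality of the classes leaves a unipotent ambiguity, and the common image of 0 forces
  that translation to be zero.\<close>

lemma transported_determined:
  assumes g: "g \<in> carrier PSL2" and h: "h \<in> carrier PSL2"
    and inf: "boundary_act g Infinity = boundary_act h Infinity"
    and zero: "boundary_act g (Fin 0) = boundary_act h (Fin 0)"
    and tr: "transported g = transported h"
  shows "g = h"
proof -
  have "inv\<^bsub>PSL2\<^esub> g \<otimes>\<^bsub>PSL2\<^esub> h \<in> unipotent" using transported_eq_iff[OF g h inf] tr by simp
  then obtain x where x: "inv\<^bsub>PSL2\<^esub> g \<otimes>\<^bsub>PSL2\<^esub> h = unip x" by (auto simp: unipotent_def)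
  have "Fin x = boundary_act (inv\<^bsub>PSL2\<^esub> g \<otimes>\<^bsub>PSL2\<^esub> h) (Fin 0)" by (simp add: x boundary_act_unip)
  also have "\<dots> = Fin 0" using g h by (simp add: boundary_act_mult boundary_act_inv flip: zero)
  finally have "inv\<^bsub>PSL2\<^esub> g \<otimes>\<^bsub>PSL2\<^esub> h = \<one>\<^bsub>PSL2\<^esub>"
    using x by (simp add: one_PSL2 psl_of_eq_iff matrix_2_eq_iff)
  then have "g \<otimes>\<^bsub>PSL2\<^esub> (inv\<^bsub>PSL2\<^esub> g \<otimes>\<^bsub>PSL2\<^esub> h) = g" using g by simp
  then show ?thesis using g h by (simp flip: PSL2.m_assoc)
qed

lemma adapted_left_unique:
  assumes "adapted l D" "adapted l' D"
  shows "l = l'"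
proof (rule extensionalityI)
  show "l \<in> extensional truncated_vertices" "l' \<in> extensional truncated_vertices"
    using assms by (simp_all add: adapted_def)
  fix ij assume "ij \<in> truncated_vertices"
  then obtain i j where "ij = (i, j)" "i \<noteq> j" by (auto simp: truncated_vertices_def)
  then show "l ij = l' ij"
    using adaptedD[OF assms(1)] adaptedD[OF assms(2)] by (simp add: transported_determined)
qed

text \<open>Distinct labels come from distinct vertices, the coset condition from the common
  decoration, and counter diagonality from the two ends of each edge being exchanged.\<close>

lemma adapted_labelings:
  assumes l: "adapted l D" and D: "D \<in> decorated_simplices"
  shows "l \<in> labelings"
proof -
  note a = adaptedD[OF l]
  have inj: "inj (fst D)" using D by (auto simp: decorated_simplices_def)
  have "l \<in> truncated_vertices \<rightarrow>\<^sub>E carrier PSL2"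
    using l a(1) by (auto simp: adapted_def truncated_vertices_def PiE_def)
  moreover have "l (i, j) \<noteq> l (i, k) \<and>
      l (i, j) <#\<^bsub>PSL2\<^esub> unipotent = l (i, k) <#\<^bsub>PSL2\<^esub> unipotent"
    if "i \<noteq> j" "i \<noteq> k" "j \<noteq> k" for i j k
  proof
    show "l (i, j) \<noteq> l (i, k)"
    proof
      assume "l (i, j) = l (i, k)"
      then have "fst D j = fst D k" using a(3) that by metis
      then show False using inj that by (simp add: inj_eq)
    qed
    have "inv\<^bsub>PSL2\<^esub> l (i, j) \<otimes>\<^bsub>PSL2\<^esub> l (i, k) \<in> unipotent"
      using transported_eq_iff[of "l (i, j)" "l (i, k)"] a that by simp
    then show "l (i, j) <#\<^bsub>PSL2\<^esub> unipotent = l (i, k) <#\<^bsub>PSL2\<^esub> unipotent"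
      using a(1) that by (simp add: unipotent_lcoset_eq)
  qed
  moreover have "inv\<^bsub>PSL2\<^esub> l (i, j) \<otimes>\<^bsub>PSL2\<^esub> l (j, i) \<in> counter_diagonal" if "i \<noteq> j" for i j
  proof -
    let ?g = "l (i, j)" and ?h = "l (j, i)"
    have gh: "?g \<in> carrier PSL2" "?h \<in> carrier PSL2" using a(1) that by simp_all
    have "boundary_act ?h Infinity = boundary_act ?g (Fin 0)"
      "boundary_act ?h (Fin 0) = boundary_act ?g Infinity"
      using a(2,3) that by simp_all
    then show ?thesis
      using gh by (simp add: counter_diagonal_iff boundary_act_mult boundary_act_inv)
  qed
  ultimately show ?thesis unfolding labelings_def by blast
qed

text \<open>Any element producing the decoration at \<open>i\<close> already sends infinity to that
  vertex; a unipotent correction on the right then sends 0 to the vertex \<open>j\<close>.\<close>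

lemma exists_adapted:
  assumes D: "D \<in> decorated_simplices"
  shows "\<exists>l. adapted l D"
proof -
  have inj: "inj (fst D)" using D by (auto simp: decorated_simplices_def)
  have "\<exists>g \<in> carrier PSL2. boundary_act g Infinity = fst D i \<and> boundary_act g (Fin 0) = fst D j \<and>
      snd D i = transported g" if ij: "i \<noteq> j" for i j
  proof -
    have "snd D i \<in> ehorospheres (fst D i) // translation_rel"
      using D by (auto simp: decorated_simplices_def)
    then obtain h where h: "h \<in> carrier PSL2" "boundary_act h Infinity = fst D i"
      "snd D i = transported h"
      using ehorosphere_classes_iff by blast
    obtain x where "\<And>m. m \<noteq> i \<Longrightarrow> boundary_act h (Fin (x m)) = fst D m"
      using boundary_coordinates[OF h(1,2) inj] by blast
    then show ?thesis
      using h ij unip_carrier[of "x j"]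
      by (intro bexI[of _ "h \<otimes>\<^bsub>PSL2\<^esub> unip (x j)"]) (simp_all add: mult_unip)
  qed
  then obtain l where l: "\<And>i j. i \<noteq> j \<Longrightarrow> l i j \<in> carrier PSL2 \<and>
      boundary_act (l i j) Infinity = fst D i \<and> boundary_act (l i j) (Fin 0) = fst D j \<and>
      snd D i = transported (l i j)"
    by metis
  have "adapted (restrict (\<lambda>(i, j). l i j) truncated_vertices) D"
    using l by (simp add: adapted_def truncated_vertices_def)
  then show ?thesis by blast
qed

section \<open>Comparison with the correspondence by triangles\<close>

text \<open>Relative to one reference \<open>g\<close>, every \<open>l (i, m)\<close> is
  \<open>g\<close> times \<open>unip (x m)\<close>. The numbers \<open>x m\<close> are the corner
  coordinates, and their differences are the values of \<open>alpha\<close>.\<close>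

lemma adapted_corresponds:
  assumes l: "adapted l D"
  shows "corresponds l D"
proof -
  note a = adaptedD[OF l]
  have "intersection_triangle D i = cutoff_triangle l i" for i
  proof -
    obtain o' where o': "o' \<noteq> i" using exists_other_index by blast
    define g where "g = l (i, o')"
    have g: "g \<in> carrier PSL2" "boundary_act g Infinity = fst D i" "snd D i = transported g"
      using a[of i o'] o' by (simp_all add: g_def)
    have "\<exists>x. l (i, m) = g \<otimes>\<^bsub>PSL2\<^esub> unip x" if m: "m \<noteq> i" for m
    proof -
      have "inv\<^bsub>PSL2\<^esub> g \<otimes>\<^bsub>PSL2\<^esub> l (i, m) \<in> unipotent"
        using transported_eq_iff[of g "l (i, m)"] g a[of i m] m by simp
      then obtain x where x: "inv\<^bsub>PSL2\<^esub> g \<otimes>\<^bsub>PSL2\<^esub> l (i, m) = unip x"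
        by (auto simp: unipotent_def)
      have "l (i, m) = g \<otimes>\<^bsub>PSL2\<^esub> (inv\<^bsub>PSL2\<^esub> g \<otimes>\<^bsub>PSL2\<^esub> l (i, m))"
        using g a(1)[of i m] m by (simp flip: PSL2.m_assoc)
      then show ?thesis unfolding x by blast
    qed
    then obtain x where x: "\<And>m. m \<noteq> i \<Longrightarrow> l (i, m) = g \<otimes>\<^bsub>PSL2\<^esub> unip (x m)" by metis
    have "boundary_act g (Fin (x m)) = fst D m" if "m \<noteq> i" for m
      using a(3)[of i m] that g(1) by (simp add: x mult_unip)
    then have tri: "intersection_triangle (fst D, snd D) i =
        {T \<in> extensional {j. j \<noteq> i}. \<exists>c. \<forall>m. m \<noteq> i \<longrightarrow> T m = x m + c}"
      using g by (intro intersection_triangle_eq)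
    have alpha: "alpha l i j k = x k - x j" if "j \<noteq> i" "k \<noteq> i" for j k
    proof -
      have "inv\<^bsub>PSL2\<^esub> l (i, j) \<otimes>\<^bsub>PSL2\<^esub> l (i, k) =
          unip (- x j) \<otimes>\<^bsub>PSL2\<^esub> (inv\<^bsub>PSL2\<^esub> g \<otimes>\<^bsub>PSL2\<^esub> (g \<otimes>\<^bsub>PSL2\<^esub> unip (x k)))"
        using g(1) unip_carrier that
        by (simp add: x PSL2.inv_mult_group inv_unip PSL2.m_assoc)
      also have "\<dots> = unip (x k - x j)"
        using g(1) unip_carrier by (simp add: unip_mult flip: PSL2.m_assoc)
      finally show ?thesis by (simp add: alpha_def unip_eq_iff)
    qed
    have "(\<exists>c. \<forall>m. m \<noteq> i \<longrightarrow> T m = x m + c) \<longleftrightarrow>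
        (\<forall>j k. j \<noteq> i \<and> k \<noteq> i \<longrightarrow> T k - T j = alpha l i j k)" for T
    proof
      assume T: "\<forall>j k. j \<noteq> i \<and> k \<noteq> i \<longrightarrow> T k - T j = alpha l i j k"
      \<comment> \<open>The translation constant is read off at the reference corner
        \<open>o'\<close>.\<close>
      have "T m = x m + (T o' - x o')" if "m \<noteq> i" for m
        using T o' that alpha[OF o' that] by (metis add_diff_eq diff_add_cancel add.commute)
      then show "\<exists>c. \<forall>m. m \<noteq> i \<longrightarrow> T m = x m + c" by blast
    qed (auto simp: alpha)
    then show ?thesis using tri by (simp add: cutoff_triangle_def)
  qed
  then show ?thesis using a by (simp add: corresponds_def)
qed

text \<open>Two euclidean horospheres at the same point giving the same triangle differ by an affine
  map which is a translation, as it is one on two distinct corners.\<close>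

lemma decoration_determined_by_triangle:
  assumes D: "(v, E) \<in> decorated_simplices" "(v, E') \<in> decorated_simplices"
    and tri: "intersection_triangle (v, E) i = intersection_triangle (v, E') i"
  shows "E i = E' i"
proof -
  have inj: "inj v" using D by (simp add: decorated_simplices_def)
  obtain g where g: "g \<in> carrier PSL2" "boundary_act g Infinity = v i" "E i = transported g"
    using D(1) ehorosphere_classes_iff unfolding decorated_simplices_def by blast
  obtain h where h: "h \<in> carrier PSL2" "boundary_act h Infinity = v i" "E' i = transported h"
    using D(2) ehorosphere_classes_iff unfolding decorated_simplices_def by blast
  obtain x where x: "\<And>m. m \<noteq> i \<Longrightarrow> boundary_act g (Fin (x m)) = v m"
    using boundary_coordinates[OF g(1,2) inj] by blast
  obtain y where y: "\<And>m. m \<noteq> i \<Longrightarrow> boundary_act h (Fin (y m)) = v m"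
    using boundary_coordinates[OF h(1,2) inj] by blast
  have tri_g: "intersection_triangle (v, E) i =
      {T \<in> extensional {j. j \<noteq> i}. \<exists>c. \<forall>m. m \<noteq> i \<longrightarrow> T m = x m + c}"
    using g x by (intro intersection_triangle_eq)
  have tri_h: "intersection_triangle (v, E') i =
      {T \<in> extensional {j. j \<noteq> i}. \<exists>c. \<forall>m. m \<noteq> i \<longrightarrow> T m = y m + c}"
    using h y by (intro intersection_triangle_eq)
  \<comment> \<open>The representative with constant 0; membership in the other description of the
    triangle yields the shift \<open>c\<close> between both coordinate systems.\<close>
  have "restrict x {j. j \<noteq> i} \<in> intersection_triangle (v, E) i"
    unfolding tri_g by (auto intro!: exI[of _ 0])
  then have "\<exists>c. \<forall>m. m \<noteq> i \<longrightarrow> restrict x {j. j \<noteq> i} m = y m + c"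
    unfolding tri tri_h by blast
  then obtain c where c: "\<And>m. m \<noteq> i \<Longrightarrow> x m = y m + c" by auto
  let ?k = "inv\<^bsub>PSL2\<^esub> g \<otimes>\<^bsub>PSL2\<^esub> h"
  have k: "?k \<in> carrier PSL2" using g h by simp
  have kp: "boundary_act ?k p = boundary_act (inv\<^bsub>PSL2\<^esub> g) (boundary_act h p)" for p
    using g h by (simp add: boundary_act_mult)
  have "boundary_act ?k Infinity = Infinity"
    using boundary_act_inv(1)[OF g(1), of Infinity] unfolding kp h(2) g(2) .
  then obtain a b d where ad: "a * d = 1" and ka: "?k = psl_of (mat2 a b 0 d)"
    by (rule psl_of_fixing_infinity[OF k])
  have d0: "d \<noteq> 0" using ad by auto
  \<comment> \<open>The affine map of \<open>?k\<close> agrees with the shift by \<open>c\<close> at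
    each corner; the denominator \<open>d\<close> is cleared.\<close>
  have aff: "a * y m + b = d * (y m + c)" if m: "m \<noteq> i" for m
  proof -
    have "boundary_act ?k (Fin (y m)) = Fin (x m)"
      using boundary_act_inv(1)[OF g(1), of "Fin (x m)"] unfolding kp y[OF m] x[OF m] .
    then show ?thesis using d0 by (simp add: ka boundary_act_psl_of c[OF m] field_simps)
  qed
  obtain m n where mn: "m \<noteq> i" "n \<noteq> i" "m \<noteq> n" using exists_two_other_indices by blast
  have "y m \<noteq> y n"
  proof
    assume "y m = y n"
    then have "v m = v n" using y mn by metis
    then show False using inj mn by (simp add: inj_eq)
  qed
  \<comment> \<open>Subtracting the equations at two corners eliminates \<open>b\<close> and
    \<open>c\<close>.\<close>
  moreover have "(a - d) * (y m - y n) =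
      (a * y m + b - d * (y m + c)) - (a * y n + b - d * (y n + c))"
    by (simp add: algebra_simps)
  then have "(a - d) * (y m - y n) = 0"
    using aff[OF mn(1)] aff[OF mn(2)] by simp
  ultimately have "a = d" by simp
  then have "d * d = 1" using ad by simp
  then have "d = 1 \<or> d = - 1" by (simp add: square_eq_1_iff)
  then have "?k \<in> unipotent"
  proof
    assume "d = - 1"
    then have "?k = unip (- b)"
      unfolding ka psl_of_eq_iff using \<open>a = d\<close> by (simp add: matrix_2_eq_iff)
    then show ?thesis by (auto simp: unipotent_def)
  qed (use \<open>a = d\<close> in \<open>auto simp: ka unipotent_def\<close>)
  then show ?thesis using transported_eq_iff[OF g(1) h(1)] g h by simp
qed

text \<open>The relation fixes vertices and triangles, and triangles determine the decoration; hence
  \<open>D\<close> is the simplex already known to be adapted to \<open>l\<close>.\<close>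

lemma corresponds_adapted:
  assumes l: "l \<in> labelings" and D: "D \<in> decorated_simplices" and c: "corresponds l D"
  shows "adapted l D"
proof -
  obtain D' where D': "D' \<in> decorated_simplices" "adapted l D'" using labeling_adapted[OF l] by blast
  have c': "corresponds l D'" by (rule adapted_corresponds[OF D'(2)])
  have "fst D i = fst D' i" for i
    using exists_other_index[of i] c c' unfolding corresponds_def by metis
  then have f: "fst D = fst D'" by (rule ext)
  have "snd D i = snd D' i" for i
    using D D'(1) c c'
    by (intro decoration_determined_by_triangle[of "fst D"]) (simp_all add: corresponds_def f[symmetric], simp_all add: f)
  then have "D = D'" using f by (simp add: prod_eq_iff fun_eq_iff)
  then show ?thesis using D'(2) by simp
qed

section \<open>Congruence classes and orbits of labelings\<close>

lemma adapted_act: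
  assumes g: "g \<in> carrier PSL2" and l: "adapted l D"
  shows "adapted (label_act g l) (decorated_act g D)"
proof -
  note a = adaptedD[OF l]
  have "label_act g l (i, j) = g \<otimes>\<^bsub>PSL2\<^esub> l (i, j)" if "i \<noteq> j" for i j
    using that by (simp add: label_act_def truncated_vertices_def)
  then show ?thesis
    unfolding adapted_def using a g
    by (simp add: label_act_def decorated_act_def case_prod_unfold boundary_act_mult
      flip: ehorosphere_act_transported)
qed

text \<open>\<open>adapted\<close> is equivariant and unique on both sides, so a group element
  relates the simplices exactly when it relates the labelings; equal generators mean equal
  orbits.\<close>

lemma congruent_iff_same_generator:
  assumes D: "D \<in> decorated_simplices" "adapted l D" and D': "D' \<in> decorated_simplices" "adapted l' D'"
  shows "(D, D') \<in> congruence \<longleftrightarrow> generator l = generator l'"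
proof -
  have "D' = decorated_act g D \<longleftrightarrow> l' = label_act g l" if "g \<in> carrier PSL2" for g
    using adapted_act[OF that D(2)] D'(2) adapted_left_unique adapted_right_unique by blast
  moreover have "l \<in> labelings" "l' \<in> labelings" using D D' adapted_labelings by blast+
  ultimately show ?thesis using D(1) D'(1) by (auto simp: congruence_def generator_eq_iff)
qed

theorem theorem3p13:
  shows "(\<forall>l \<in> labelings. \<exists>!D. D \<in> decorated_simplices \<and> corresponds l D) \<and>
    (\<exists>F. bij_betw F Bbar3_generators (decorated_simplices // congruence) \<and>
         (\<forall>l \<in> labelings. \<forall>D \<in> decorated_simplices.
            corresponds l D \<longrightarrow> F (generator l) = congruence `` {D}))"
proof
  show "\<forall>l \<in> labelings. \<exists>!D. D \<in> decorated_simplices \<and> corresponds l D"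
    using labeling_adapted adapted_corresponds corresponds_adapted adapted_right_unique by metis
next
  define dec where "dec l = (THE D. adapted l D)" for l
  have dec: "dec l = D" if "adapted l D" for l D
    unfolding dec_def using that adapted_right_unique by blast
  have dec_mem: "dec l \<in> decorated_simplices" "adapted l (dec l)" if "l \<in> labelings" for l
    using labeling_adapted[OF that] dec by auto
  have class_eq: "congruence `` {dec l} = dec ` {m \<in> labelings. generator m = generator l}"
    if l: "l \<in> labelings" for l
  proof (intro equalityI subsetI)
    fix D assume D: "D \<in> congruence `` {dec l}"
    then have D': "D \<in> decorated_simplices" by (simp add: congruence_def)
    then obtain m where m: "adapted m D" using exists_adapted by blast
    then have "generator m = generator l"
      using D congruent_iff_same_generator[OF dec_mem[OF l] D' m] by simp
    then show "D \<in> dec ` {m \<in> labelings. generator m = generator l}"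
      using dec[OF m] adapted_labelings[OF m D'] by blast
  next
    fix D assume "D \<in> dec ` {m \<in> labelings. generator m = generator l}"
    then obtain m where m: "D = dec m" "m \<in> labelings" "generator m = generator l" by blast
    then show "D \<in> congruence `` {dec l}"
      using congruent_iff_same_generator[OF dec_mem[OF l] dec_mem[OF m(2)]] by simp
  qed
  \<comment> \<open>The image of a whole fibre of \<open>generator\<close>, so that no
    representative is chosen; by \<open>class_eq\<close> it is a full congruence class.\<close>
  define F where "F c = dec ` {m \<in> labelings. generator m = c}" for c
  have F: "F (generator l) = congruence `` {dec l}" if "l \<in> labelings" for l
    using class_eq[OF that] by (simp add: F_def)
  have "inj_on F Bbar3_generators"
  proof (rule inj_onI)
    fix c c' assume "c \<in> Bbar3_generators" "c' \<in> Bbar3_generators" and eq: "F c = F c'"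
    then obtain l l' where l: "l \<in> labelings" "c = generator l" and l': "l' \<in> labelings" "c' = generator l'"
      by (auto simp: Bbar3_generators_def)
    have "dec l' \<in> F c'" unfolding F_def using l' by blast
    then have "dec l' \<in> congruence `` {dec l}" using eq F[OF l(1)] l(2) by metis
    then have "(dec l, dec l') \<in> congruence" by simp
    then show "c = c'" using congruent_iff_same_generator dec_mem l l' by metis
  qed
  moreover have "F ` Bbar3_generators = decorated_simplices // congruence"
  proof (intro equalityI subsetI)
    fix X assume "X \<in> F ` Bbar3_generators"
    then obtain l where "l \<in> labelings" "X = congruence `` {dec l}"
      using F by (auto simp: Bbar3_generators_def)
    then show "X \<in> decorated_simplices // congruence" using dec_mem by (auto intro: quotientI)
  next
    fix X assume "X \<in> decorated_simplices // congruence"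
    then obtain D where D: "D \<in> decorated_simplices" "X = congruence `` {D}" by (rule quotientE)
    obtain l where l: "adapted l D" using exists_adapted[OF D(1)] by blast
    then have "l \<in> labelings" using D adapted_labelings by blast
    then show "X \<in> F ` Bbar3_generators"
      using F dec[OF l] D by (auto simp: Bbar3_generators_def)
  qed
  ultimately have "bij_betw F Bbar3_generators (decorated_simplices // congruence)"
    by (simp add: bij_betw_def)
  moreover have "F (generator l) = congruence `` {D}"
    if "l \<in> labelings" "D \<in> decorated_simplices" "corresponds l D" for l D
    using F dec corresponds_adapted that by metis
  ultimately show "\<exists>F. bij_betw F Bbar3_generators (decorated_simplices // congruence) \<and>
         (\<forall>l \<in> labelings. \<forall>D \<in> decorated_simplices.
            corresponds l D \<longrightarrow> F (generator l) = congruence `` {D})"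
    by blast
qed

end
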